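(* Let $\phi(T)=T^3-AT+B$ be in standard form, with function field $\mathcal{F}$. The place at infinity $\infty$ of $\mathbb{F}_q(x)$ splits in $\mathcal{F}$ as follows, where different letters denote distinct places of $\mathcal{F}$: 1. If $3\nmid\deg B$ and $2\deg B>3\deg A$, then $(\infty)=\mathfrak{p}^3$. 2. If $2\deg B\le 3\deg A$ and $\deg A$ is odd, then $(\infty)=\mathfrak{p}\mathfrak{q}^2$. 3. If $2\deg B\le 3\deg A$ and $\deg A=2n$ is even, let $a_{2n}$ be the coefficient of $x^{2n}$ in $A$, let $b_{3n}$ be the coefficient of $x^{3n}$ in $B$ (possibly zero), and let $d=\gcd(T^q-T,\ T^3-a_{2n}T+b_{3n})\in\mathbb{F}_q[T]$. (a) If $\deg d=0$, then $(\infty)=\mathfrak{p}$. (b) If $\deg d=1$, then $(\infty)=\mathfrak{p}\mathfrak{q}$. (c) If $\deg d=3$, then $(\infty)=\mathfrak{p}\mathfrak{q}\mathfrak{r}$.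
   Context: $q$ is a power of $3$. $A,B\in\mathbb{F}_q[x]$, $A\neq 0$, and $T^3-AT+B\in\mathbb{F}_q[x,T]$ is absolutely irreducible; $\mathcal{F}=\mathbb{F}_q(x,y)$ with $y^3-Ay+B=0$. The place at infinity of $\mathbb{F}_q(x)$ is the one with uniformizer $1/x$. The polynomial $T^3-AT+B$ is in standard form if (a) there are no non-constant $Q\in\mathbb{F}_q[x]$ and $i\in\mathbb{F}_q[x]$ with $Q^2\mid A$ and $Q^3\mid i^3-iA+B$, and (b) either $3\nmid\deg B$ and $2\deg B>3\deg A$, or $2\deg B\le 3\deg A$. The notation $(\infty)=\prod \mathfrak{p}_j^{e_j}$ means that the $\mathfrak{p}_j$ are exactly the places of $\mathcal{F}$ above $\infty$, with ramification indices $e_j$. *)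

theory Defs
  imports "HOL-Algebra.Algebraic_Closure_Type" "HOL-Algebra.Generated_Fields" "HOL-Library.Cardinality"
begin

hide_const (open) Polynomials.degree Divisibility.irreducible

text \<open>Fields are types of class \<open>field\<close>. Subrings and subfields of a field type are those of
  HOL-Algebra, taken with respect to the ring \<open>ring_of_type_algebra\<close> whose carrier is the whole
  type.\<close>


section \<open>Places\<close>

text \<open>\<open>F\<close> is a subfield of an ambient field, regarded as a function field over the constants
  \<open>K\<close>.\<close>

definition valuation_ring :: "'l::field set \<Rightarrow> 'l set \<Rightarrow> 'l set \<Rightarrow> bool" where
  "valuation_ring K F V \<longleftrightarrow> subring V ring_of_type_algebra \<and> K \<subset> V \<and> V \<subset> F \<and>
     (\<forall>z\<in>F. z \<in> V \<or> inverse z \<in> V)"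

text \<open>The non-units of a valuation ring form its maximal ideal.\<close>

definition place :: "'l::field set \<Rightarrow> 'l set \<Rightarrow> 'l set \<Rightarrow> bool" where
  "place K F P \<longleftrightarrow> (\<exists>V. valuation_ring K F V \<and> P = {z \<in> V. z = 0 \<or> inverse z \<notin> V})"

text \<open>The valuation ring is recovered from its maximal ideal \<open>P\<close>; see the lemma
  \<open>place_ring_eq\<close>.\<close>

definition place_ring :: "'l::field set \<Rightarrow> 'l set \<Rightarrow> 'l set" where
  "place_ring F P = {z \<in> F. z = 0 \<or> inverse z \<notin> P}"

definition uniformizer :: "'l::field set \<Rightarrow> 'l set \<Rightarrow> 'l \<Rightarrow> bool" where
  "uniformizer F P t \<longleftrightarrow> P = (\<lambda>z. t * z) ` place_ring F P"

text \<open>The normalized discrete valuation attached to a place; only meaningful for \<open>z \<noteq> 0\<close>.\<close>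

definition place_val :: "'l::field set \<Rightarrow> 'l set \<Rightarrow> 'l \<Rightarrow> int" where
  "place_val F P z = (THE n. \<exists>t u. uniformizer F P t \<and> u \<in> place_ring F P \<and> u \<noteq> 0 \<and>
     inverse u \<in> place_ring F P \<and> z = t powi n * u)"

text \<open>For a subfield \<open>E\<close> of \<open>F\<close>, a place \<open>p\<close> of \<open>E\<close> and a place \<open>P\<close> of \<open>F\<close>.\<close>

definition lies_over :: "'l set \<Rightarrow> 'l set \<Rightarrow> bool" where
  "lies_over P p \<longleftrightarrow> p \<subseteq> P"

definition ramification_index :: "'l::field set \<Rightarrow> 'l set \<Rightarrow> 'l set \<Rightarrow> 'l set \<Rightarrow> nat" where
  "ramification_index E F p P =
     (THE e. \<forall>z\<in>E - {0}. place_val F P z = int e * place_val E p z)"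

text \<open>The prime decomposition of \<open>p\<close> in \<open>F\<close>, given as a list of pairs of a place and an
  exponent.\<close>

definition splits_as ::
  "'l::field set \<Rightarrow> 'l set \<Rightarrow> 'l set \<Rightarrow> 'l set \<Rightarrow> ('l set \<times> nat) list \<Rightarrow> bool" where
  "splits_as K E F p ps \<longleftrightarrow>
     distinct (map fst ps) \<and>
     fst ` set ps = {P. place K F P \<and> lies_over P p} \<and>
     (\<forall>(P, e) \<in> set ps. ramification_index E F p P = e)"

lemma place_ring_eq:
  assumes "valuation_ring K F V"
  shows "place_ring F {z \<in> V. z = 0 \<or> inverse z \<notin> V} = V"
proof -
  have "(0::'a) \<in> V"
    using assms subring.axioms(1) subringE(2)
    by (fastforce simp: valuation_ring_def ring_of_type_algebra_def)
  thus ?thesis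
    using assms by (auto simp: place_ring_def valuation_ring_def)
qed


section \<open>The rational function field and its infinite place\<close>

text \<open>In the following, \<open>\<iota>\<close> is an embedding of the rational function field over the field \<open>'k\<close>
  into an ambient field. Taking \<open>'l\<close> to be the algebraic closure of \<^typ>\<open>'k poly fract\<close>
  and \<open>\<iota>\<close> to be \<^const>\<open>to_ac\<close> is one possibility.\<close>

definition constants :: "('k::field poly fract \<Rightarrow> 'l::field) \<Rightarrow> 'l set" where
  "constants \<iota> = range (\<lambda>c. \<iota> (Fract [:c:] 1))"

definition infinite_place :: "('k::field poly fract \<Rightarrow> 'l::field) \<Rightarrow> 'l set" where
  "infinite_place \<iota> = {\<iota> (Fract f g) |f g. g \<noteq> 0 \<and> degree f < degree g}"

text \<open>The subfield generated by the image of \<open>\<iota>\<close> together with \<open>y\<close>.\<close>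

definition adjoin_root :: "('k::field poly fract \<Rightarrow> 'l::field) \<Rightarrow> 'l \<Rightarrow> 'l set" where
  "adjoin_root \<iota> y = generate_field ring_of_type_algebra (insert y (range \<iota>))"

definition infinity_splits_as ::
  "('k::field poly fract \<Rightarrow> 'l::field) \<Rightarrow> 'l \<Rightarrow> ('l set \<times> nat) list \<Rightarrow> bool" where
  "infinity_splits_as \<iota> y ps \<longleftrightarrow>
     splits_as (constants \<iota>) (range \<iota>) (adjoin_root \<iota> y) (infinite_place \<iota>) ps"

lemma infinite_place_is_place:
  fixes \<iota> :: "'k::field poly fract \<Rightarrow> 'l::field"
  assumes "\<iota> \<in> ring_hom ring_of_type_algebra ring_of_type_algebra"
  shows "place (constants \<iota>) (range \<iota>) (infinite_place \<iota>)"
    and "uniformizer (range \<iota>) (infinite_place \<iota>) (\<iota> (Fract 1 [:0, 1:]))"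
proof -
  have add: "\<iota> (a + b) = \<iota> a + \<iota> b" and mult: "\<iota> (a * b) = \<iota> a * \<iota> b" and one: "\<iota> 1 = 1" for a b
    using assms by (auto simp: ring_hom_def ring_of_type_algebra_def)
  have zero: "\<iota> 0 = 0" by (metis add add_0_right add_cancel_left_right)
  have minus: "\<iota> (- a) = - \<iota> a" for a
    using add[of a "- a"] by (simp add: zero add_eq_0_iff)
  have eq0: "\<iota> a = 0 \<longleftrightarrow> a = 0" for a
    using mult[of a "inverse a"] by (cases "a = 0") (auto simp: zero one)
  have inj: "\<iota> a = \<iota> b \<longleftrightarrow> a = b" for a b
    using add[of a "- b"] eq0[of "a - b"] by (auto simp: minus)
  have inv: "\<iota> (inverse a) = inverse (\<iota> a)" for a
    using mult[of a "inverse a"] by (cases "a = 0") (auto simp: zero one intro!: inverse_unique [symmetric])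
  define D where "D = {Fract f g |f g :: 'k poly. g \<noteq> 0 \<and> degree f \<le> degree g}"
  have D_iff: "Fract f g \<in> D \<longleftrightarrow> degree f \<le> degree g" if "g \<noteq> 0" for f g :: "'k poly"
  proof
    assume "Fract f g \<in> D"
    then obtain f' g' where *: "Fract f g = Fract f' g'" "g' \<noteq> 0" "degree f' \<le> degree g'"
      by (auto simp: D_def)
    hence **: "f * g' = f' * g" using that by (simp add: eq_fract)
    show "degree f \<le> degree g"
    proof (cases "f = 0")
      case False
      hence "f' \<noteq> 0" using ** * by auto
      hence "degree f + degree g' = degree f' + degree g"
        using ** False * that by (metis degree_mult_eq)
      thus ?thesis using * by simp
    qed auto
  qed (use that in \<open>auto simp: D_def\<close>)
  have Dadd: "a + b \<in> D" if ab: "a \<in> D" "b \<in> D" for a b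
  proof -
    obtain f g f' g' where *: "a = Fract f g" "g \<noteq> 0" "degree f \<le> degree g"
      "b = Fract f' g'" "g' \<noteq> 0" "degree f' \<le> degree g'" using ab unfolding D_def by blast
    have "degree (f * g' + f' * g) \<le> degree (g * g')"
      using * by (intro degree_add_le order.trans[OF degree_mult_le]) (auto simp: degree_mult_eq)
    thus ?thesis using * by (simp add: D_iff)
  qed
  have Dmult: "a * b \<in> D" if ab: "a \<in> D" "b \<in> D" for a b
  proof -
    obtain f g f' g' where *: "a = Fract f g" "g \<noteq> 0" "degree f \<le> degree g"
      "b = Fract f' g'" "g' \<noteq> 0" "degree f' \<le> degree g'" using ab unfolding D_def by blast
    have "degree (f * f') \<le> degree (g * g')"
      using * by (intro order.trans[OF degree_mult_le]) (auto simp: degree_mult_eq)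
    thus ?thesis using * by (simp add: D_iff)
  qed
  have Dminus: "- a \<in> D" if "a \<in> D" for a
    using that by (cases a) (simp add: D_iff)
  have D1: "1 \<in> D" using D_iff[of 1 1] by (simp add: One_fract_def)
  have D0: "0 \<in> D" using D_iff[of 1 0] by (simp add: Zero_fract_def)
  define V where "V = \<iota> ` D"
  have iV: "\<iota> a \<in> V \<longleftrightarrow> a \<in> D" for a using inj by (auto simp: V_def)
  have sub: "subring V ring_of_type_algebra"
  proof (rule ring.subringI)
    show "ring (ring_of_type_algebra :: 'l ring)" by (rule ring_from_type_algebra)
    then interpret R: ring "ring_of_type_algebra :: 'l ring" .
    have am: "\<ominus>\<^bsub>ring_of_type_algebra\<^esub> z = - z" for z :: 'l
      using R.minus_equality[of "-z" z] by (simp add: ring_of_type_algebra_def)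
    show "\<ominus>\<^bsub>ring_of_type_algebra\<^esub> h \<in> V" if "h \<in> V" for h
      using that Dminus by (auto simp: am V_def simp flip: minus)
  qed (use Dadd Dmult D1 in \<open>auto simp: ring_of_type_algebra_def V_def simp flip: add mult one\<close>)
  have inD: "a \<in> D \<or> inverse a \<in> D" for a
  proof (cases a)
    case (Fract f g)
    thus ?thesis using D_iff[of g f] D_iff[of f g] D0
      by (cases "f = 0") (auto simp: fract_collapse)
  qed
  have x: "Fract [:0, 1:] 1 \<notin> D" by (simp add: D_iff)
  have x': "Fract 1 [:0, 1:] \<in> D" by (simp add: D_iff)
  have cV: "constants \<iota> \<subset> V"
  proof
    show "constants \<iota> \<subseteq> V" by (auto simp: constants_def iV D_iff)
    have "Fract 1 [:0, 1:] \<noteq> Fract [:c:] 1" for c :: 'k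
      by (auto simp: eq_fract one_pCons)
    hence "\<iota> (Fract 1 [:0, 1:]) \<notin> constants \<iota>" by (auto simp: constants_def inj)
    thus "constants \<iota> \<noteq> V" using x' iV by blast
  qed
  have VF: "V \<subset> range \<iota>" using x iV by (auto simp: V_def)
  have val: "valuation_ring (constants \<iota>) (range \<iota>) V"
    unfolding valuation_ring_def using sub cV VF inD by (auto simp: iV simp flip: inv)
  have P: "infinite_place \<iota> = {z \<in> V. z = 0 \<or> inverse z \<notin> V}"
  proof -
    have *: "Fract f g = 0 \<or> inverse (Fract f g) \<notin> D \<longleftrightarrow> f = 0 \<or> degree f < degree g"
      if "g \<noteq> 0" for f g :: "'k poly"
    proof (cases "f = 0")
      case False
      have "Fract f g \<noteq> Fract 0 1" using False that by (simp add: eq_fract)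
      thus ?thesis using False by (auto simp: D_iff fract_collapse)
    qed (simp add: fract_collapse)
    have **: "{z \<in> V. z = 0 \<or> inverse z \<notin> V} = \<iota> ` {a \<in> D. a = 0 \<or> inverse a \<notin> D}"
      by (auto simp: V_def eq0 inj simp flip: inv)
    have "{a \<in> D. a = 0 \<or> inverse a \<notin> D} = {Fract f g |f g. g \<noteq> 0 \<and> degree f < degree g}"
    proof (intro equalityI subsetI)
      fix a assume a: "a \<in> {a \<in> D. a = 0 \<or> inverse a \<notin> D}"
      show "a \<in> {Fract f g |f g. g \<noteq> 0 \<and> degree f < degree g}"
      proof (cases "a = 0")
        case True
        hence "a = Fract 0 [:0, 1:]" by (simp add: fract_collapse)
        thus ?thesis by force
      next
        case False
        obtain f g where fg: "a = Fract f g" "g \<noteq> 0" by (cases a) auto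
        thus ?thesis using a False *[of g f] by (auto simp: fract_collapse)
      qed
    next
      fix a assume "a \<in> {Fract f g |f g :: 'k poly. g \<noteq> 0 \<and> degree f < degree g}"
      thus "a \<in> {a \<in> D. a = 0 \<or> inverse a \<notin> D}" using * by (force simp: D_iff)
    qed
    thus ?thesis unfolding ** infinite_place_def by (auto simp: image_def)
  qed
  show "place (constants \<iota>) (range \<iota>) (infinite_place \<iota>)"
    using val P by (auto simp: place_def)
  have ring: "place_ring (range \<iota>) (infinite_place \<iota>) = V"
    using place_ring_eq[OF val] by (simp add: P)
  show "uniformizer (range \<iota>) (infinite_place \<iota>) (\<iota> (Fract 1 [:0, 1:]))"
    unfolding uniformizer_def ring
  proof (intro equalityI subsetI)
    fix z assume "z \<in> infinite_place \<iota>"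
    then obtain f g where fg: "z = \<iota> (Fract f g)" "g \<noteq> 0" "degree f < degree g"
      by (auto simp: infinite_place_def)
    have "z = \<iota> (Fract 1 [:0, 1:]) * \<iota> (Fract ([:0, 1:] * f) g)"
      using fg by (simp flip: mult add: inj eq_fract)
    moreover have "degree ([:0, 1:] * f) \<le> degree g"
      using fg by (intro order.trans[OF degree_mult_le]) auto
    ultimately show "z \<in> (\<lambda>z. \<iota> (Fract 1 [:0, 1:]) * z) ` V"
      using fg by (metis D_iff iV image_eqI)
  next
    fix z assume "z \<in> (\<lambda>z. \<iota> (Fract 1 [:0, 1:]) * z) ` V"
    then obtain f g where fg: "z = \<iota> (Fract f ([:0, 1:] * g))" "g \<noteq> 0" "degree f \<le> degree g"
      by (auto simp: V_def D_def simp flip: mult)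
    have "degree ([:0, 1:] * g) = Suc (degree g)" using fg by (subst degree_mult_eq) auto
    moreover from this have "[:0, 1:] * g \<noteq> 0" by force
    ultimately show "z \<in> infinite_place \<iota>"
      unfolding infinite_place_def using fg by force
  qed
qed


section \<open>Cubics\<close>

text \<open>The polynomial $T^3 - aT + b$.\<close>

definition cubic :: "'a::comm_ring_1 \<Rightarrow> 'a \<Rightarrow> 'a poly" where
  "cubic a b = [:b, - a, 0, 1:]"

text \<open>A polynomial in $k[x,T]$ is represented as a polynomial in $T$ over $k[x]$.\<close>

definition absolutely_irreducible :: "'k::field poly poly \<Rightarrow> bool" where
  "absolutely_irreducible p \<longleftrightarrow>
     irreducible (map_poly (map_poly to_ac) p :: 'k alg_closure poly poly)"

definition standard_form :: "'k::field poly \<Rightarrow> 'k poly \<Rightarrow> bool" where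
  "standard_form A B \<longleftrightarrow>
     \<not> (\<exists>Q i. degree Q > 0 \<and> Q ^ 2 dvd A \<and> Q ^ 3 dvd i ^ 3 - i * A + B) \<and>
     (\<not> 3 dvd degree B \<and> 2 * degree B > 3 * degree A \<or> 2 * degree B \<le> 3 * degree A)"

text \<open>The library's \<^const>\<open>gcd\<close> on polynomials needs more than the class \<open>field\<close> on the
  coefficients. A gcd as below is unique up to units; in particular its degree is determined.\<close>

definition is_gcd :: "'a::comm_semiring_1 \<Rightarrow> 'a \<Rightarrow> 'a \<Rightarrow> bool" where
  "is_gcd d a b \<longleftrightarrow> d dvd a \<and> d dvd b \<and> (\<forall>c. c dvd a \<and> c dvd b \<longrightarrow> c dvd d)"

end

theory Submission
  imports Defs
begin

text \<open>Let \<open>t = 1 / x\<close>, and let \<open>O\<close> be the valuation ring of the place at infinity. For a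
  suitable integer \<open>n\<close> and \<open>\<tau> \<in> {1, t}\<close>, the generator \<open>\<theta> = y t ^ n\<close> satisfies
  \<open>\<tau> \<theta>\<^sup>3 - \<alpha> \<theta> + \<beta> = 0\<close> with \<open>\<alpha> = \<tau> A t ^ (2 n)\<close> and
  \<open>\<beta> = \<tau> B t ^ (3 n)\<close> in \<open>O\<close>. The splitting of infinity is governed by the zeros on the projective
  line of the binary cubic form \<open>\<tau> X\<^sup>3 - \<alpha> X Y\<^sup>2 + \<beta> Y\<^sup>3\<close> reduced modulo \<open>t\<close>:

  \<^item> If \<open>2 deg B > 3 deg A\<close> and \<open>deg B = 3 n - 1\<close>, take \<open>\<tau> = 1\<close>. The reduced form is
    \<open>X\<^sup>3\<close>, and \<open>\<beta>\<close> is \<open>t\<close> times a unit.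
  \<^item> If \<open>2 deg B > 3 deg A\<close> and \<open>deg B = 3 n + 1\<close>, take \<open>\<tau> = t\<close>. The reduced form is a
    multiple of \<open>Y\<^sup>3\<close>.
  \<^item> If \<open>2 deg B \<le> 3 deg A\<close> and \<open>deg A = 2 n + 1\<close>, take \<open>\<tau> = t\<close>. The reduced form is
    \<open>Y\<^sup>2\<close> times another linear form.
  \<^item> If \<open>2 deg B \<le> 3 deg A\<close> and \<open>deg A = 2 n\<close>, take \<open>\<tau> = 1\<close>. The reduced form is
    separable, because the derivative of \<open>T\<^sup>3 - a T + b\<close> is the constant \<open>- a \<noteq> 0\<close>. The roots of
    \<open>d\<close> are the roots of this polynomial in the finite field, and when \<open>d\<close> has degree 3 there are
    three of them.

  The link is the ring \<open>R = O + O \<tau>\<theta> + O \<tau>\<theta>\<^sup>2\<close> of Delone and Faddeev (locale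
  \<open>cubic_order\<close>). A zero of the reduced form defines a homomorphism from \<open>R\<close> to the algebraic closure of the residue field, and conjugate zeros have the same kernel. In each
  of the cases the localization of \<open>R\<close> at such a kernel has a principal maximal ideal, generated by some \<open>\<pi>\<close>,
  and is therefore a discrete valuation ring (\<open>dvr_loc\<close>); the ramification index is the exponent \<open>e\<close> in
  \<open>t = \<pi> ^ e\<close> up to a unit.

  Conversely, a valuation ring above infinity contains \<open>R\<close>, whose elements are integral over \<open>O\<close>.
  Its maximal ideal is prime and contains \<open>t\<close>. In \<open>R\<close>, a product of generators of the kernels is
  divisible by \<open>t\<close>, so this maximal ideal contains one of the kernels. Then the valuation ring contains the
  localization, and equals it because discrete valuation rings are maximal proper subrings (\<open>loc_unique\<close>). All
  this uses that \<open>1, y, y\<^sup>2\<close> are linearly independent over the rational functions: a linear dependence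
  would give a rational root of the cubic, this root would be a polynomial (\<open>integral_cubic_root\<close>), and the cubic
  would be reducible.\<close>

section \<open>Subrings and subfields of a field type\<close>

text \<open>The record-based notions of subring and subfield, unfolded into closure conditions on sets so that
  membership goals can be settled by rewriting.\<close>

definition is_subring :: "'a::field set \<Rightarrow> bool" where
  "is_subring S \<longleftrightarrow> 1 \<in> S \<and> (\<forall>x\<in>S. \<forall>y\<in>S. x - y \<in> S \<and> x * y \<in> S)"

definition is_subfield :: "'a::field set \<Rightarrow> bool" where
  "is_subfield S \<longleftrightarrow> is_subring S \<and> (\<forall>x\<in>S. inverse x \<in> S)"

lemma is_subring_closed:
  assumes "is_subring S"
  shows "1 \<in> S" and "0 \<in> S"
    and "x \<in> S \<Longrightarrow> y \<in> S \<Longrightarrow> x - y \<in> S" and "x \<in> S \<Longrightarrow> - x \<in> S"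
    and "x \<in> S \<Longrightarrow> y \<in> S \<Longrightarrow> x + y \<in> S" and "x \<in> S \<Longrightarrow> y \<in> S \<Longrightarrow> x * y \<in> S"
    and "x \<in> S \<Longrightarrow> x ^ n \<in> S"
proof -
  show one: "1 \<in> S" using assms by (simp add: is_subring_def)
  have diff: "u - v \<in> S" and mult: "u * v \<in> S" if "u \<in> S" "v \<in> S" for u v
    using assms that by (auto simp: is_subring_def)
  show zero: "0 \<in> S" using diff[OF one one] by simp
  have neg: "- u \<in> S" if "u \<in> S" for u using diff[OF zero that] by simp
  show "x \<in> S \<Longrightarrow> - x \<in> S" by (rule neg)
  show "x \<in> S \<Longrightarrow> y \<in> S \<Longrightarrow> x - y \<in> S" by (rule diff)
  show "x \<in> S \<Longrightarrow> y \<in> S \<Longrightarrow> x + y \<in> S" using diff[of x "- y"] neg[of y] by simp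
  show "x \<in> S \<Longrightarrow> y \<in> S \<Longrightarrow> x * y \<in> S" by (rule mult)
  show "x \<in> S \<Longrightarrow> x ^ n \<in> S" by (induction n) (auto simp: one mult)
qed

lemma is_subfield_closed:
  assumes "is_subfield S"
  shows "is_subring S" and "x \<in> S \<Longrightarrow> inverse x \<in> S"
    and "x \<in> S \<Longrightarrow> y \<in> S \<Longrightarrow> x / y \<in> S"
proof -
  show S: "is_subring S" and inv: "x \<in> S \<Longrightarrow> inverse x \<in> S" for x
    using assms by (auto simp: is_subfield_def)
  show "x \<in> S \<Longrightarrow> y \<in> S \<Longrightarrow> x / y \<in> S"
    by (simp add: divide_inverse inv is_subring_closed[OF S])
qed

lemma a_inv_type_algebra: "\<ominus>\<^bsub>ring_of_type_algebra\<^esub> (x :: 'a::field) = - x"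
proof -
  interpret ring "ring_of_type_algebra :: 'a ring" by (rule ring_from_type_algebra)
  show ?thesis using minus_equality[of "- x" x] by (simp add: ring_of_type_algebra_def)
qed

lemma m_inv_type_algebra:
  assumes "(x :: 'a::field) \<noteq> 0"
  shows "inv\<^bsub>ring_of_type_algebra\<^esub> x = inverse x"
proof -
  interpret Ring.field "ring_of_type_algebra :: 'a ring" by (rule field_from_type_algebra)
  show ?thesis
    using assms comm_inv_char[of x "inverse x"] by (simp add: ring_of_type_algebra_def)
qed

lemma subring_type_algebra_iff:
  "subring S (ring_of_type_algebra :: 'a::field ring) \<longleftrightarrow> is_subring S"
proof
  interpret ring "ring_of_type_algebra :: 'a ring" by (rule ring_from_type_algebra)
  show "is_subring S \<Longrightarrow> subring S (ring_of_type_algebra :: 'a ring)"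
    by (rule subringI)
      (simp_all add: a_inv_type_algebra is_subring_closed, simp_all add: ring_of_type_algebra_def is_subring_closed)
  assume S: "subring S (ring_of_type_algebra :: 'a ring)"
  note E = subringE(3,5,6,7)[OF S]
  have neg: "- x \<in> S" if "x \<in> S" for x using E(2)[OF that] by (simp add: a_inv_type_algebra)
  have add: "x + y \<in> S" and mult: "x * y \<in> S" if "x \<in> S" "y \<in> S" for x y
    using E(3,4)[OF that] by (simp_all add: ring_of_type_algebra_def)
  have "1 \<in> S" using E(1) by (simp add: ring_of_type_algebra_def)
  moreover have "x - y \<in> S" if "x \<in> S" "y \<in> S" for x y
    using add[of x "- y"] neg that by simp
  ultimately show "is_subring S" by (simp add: is_subring_def mult)
qed

section \<open>Valuation rings and discrete valuation rings\<close>

definition unit_in :: "'a::field set \<Rightarrow> 'a \<Rightarrow> bool" where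
  "unit_in V u \<longleftrightarrow> u \<noteq> 0 \<and> u \<in> V \<and> inverse u \<in> V"

definition nonunits :: "'a::field set \<Rightarrow> 'a set" where
  "nonunits V = {z \<in> V. z = 0 \<or> inverse z \<notin> V}"

lemma unit_in_mult:
  "is_subring V \<Longrightarrow> unit_in V u \<Longrightarrow> unit_in V v \<Longrightarrow> unit_in V (u * v)"
  by (auto simp: unit_in_def is_subring_closed)

lemma unit_in_inverse: "unit_in V u \<Longrightarrow> unit_in V (inverse u)"
  by (auto simp: unit_in_def)

lemma unit_in_power: "is_subring V \<Longrightarrow> unit_in V u \<Longrightarrow> unit_in V (u ^ n)"
  by (induction n) (auto simp: unit_in_mult, auto simp: unit_in_def is_subring_closed)

lemma unit_in_powi: "is_subring V \<Longrightarrow> unit_in V u \<Longrightarrow> unit_in V (u powi n)"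
  by (simp add: power_int_def unit_in_power unit_in_inverse)

lemma unit_in_mono: "unit_in V u \<Longrightarrow> V \<subseteq> W \<Longrightarrow> unit_in W u"
  by (auto simp: unit_in_def)

lemma place_iff: "place K F P \<longleftrightarrow> (\<exists>V. valuation_ring K F V \<and> P = nonunits V)"
  by (simp add: place_def nonunits_def)

lemma place_ring_nonunits: "valuation_ring K F V \<Longrightarrow> place_ring F (nonunits V) = V"
  unfolding nonunits_def by (rule place_ring_eq)

locale valuation_subring =
  fixes F V :: "'l::field set"
  assumes F: "is_subfield F" and V: "is_subring V" and VF: "V \<subseteq> F"
    and total: "\<And>z. z \<in> F \<Longrightarrow> z \<in> V \<or> inverse z \<in> V"
begin

lemma nonunits_mult: "x \<in> nonunits V \<Longrightarrow> y \<in> V \<Longrightarrow> x * y \<in> nonunits V"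
proof -
  assume x: "x \<in> nonunits V" and y: "y \<in> V"
  have "inverse x \<in> V" if "inverse (x * y) \<in> V" "x * y \<noteq> 0"
  proof -
    have "inverse x = inverse (x * y) * y" using that by simp
    thus ?thesis using that y V by (metis is_subring_closed(6))
  qed
  thus ?thesis using x y V by (auto simp: nonunits_def is_subring_closed)
qed

lemma one_notin_nonunits: "1 \<notin> nonunits V"
  using V by (auto simp: nonunits_def is_subring_closed)

text \<open>One of the quotients \<open>x / y\<close> and \<open>y / x\<close> lies in \<open>V\<close>, so the sum is a multiple of \<open>x\<close> or
  of \<open>y\<close>.\<close>

lemma nonunits_add:
  assumes x: "x \<in> nonunits V" and y: "y \<in> nonunits V"
  shows "x + y \<in> nonunits V"
proof -
  have xy: "x \<in> V" "y \<in> V" using x y by (auto simp: nonunits_def)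
  have *: "u + v \<in> nonunits V"
    if u: "u \<in> nonunits V" and v: "v \<in> nonunits V" and uv: "v / u \<in> V" "u \<noteq> 0" for u v
  proof -
    have "u * (1 + v / u) \<in> nonunits V"
      using u uv V by (intro nonunits_mult) (auto simp: is_subring_closed)
    moreover have "u * (1 + v / u) = u + v" using uv by (simp add: distrib_left)
    ultimately show ?thesis by simp
  qed
  show ?thesis
  proof (cases "x = 0 \<or> y = 0")
    case False
    have "y / x \<in> V \<or> x / y \<in> V"
      using total[of "y / x"] xy VF F is_subfield_closed(3)[OF F, of y x] by auto
    thus ?thesis using *[OF x y] *[OF y x] False by (auto simp: add.commute)
  qed (use x y in auto)
qed

lemma nonunits_prime:
  assumes "x * y \<in> nonunits V" "x \<in> V" "y \<in> V"
  shows "x \<in> nonunits V \<or> y \<in> nonunits V"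
proof (rule ccontr)
  assume "\<not> ?thesis"
  hence "unit_in V (x * y)"
    using assms V by (intro unit_in_mult) (auto simp: nonunits_def unit_in_def)
  thus False using assms by (auto simp: nonunits_def unit_in_def)
qed

text \<open>If \<open>z\<close> is not in \<open>V\<close>, then \<open>1 / z\<close> is a nonunit, and dividing the equation by
  \<open>z ^ 3\<close> exhibits \<open>1\<close> as a nonunit.\<close>

lemma integral_closed:
  assumes z: "z \<in> F" "z ^ 3 = p + q * z + r * z ^ 2" and c: "p \<in> V" "q \<in> V" "r \<in> V"
  shows "z \<in> V"
proof (rule ccontr)
  assume zV: "z \<notin> V"
  hence z0: "z \<noteq> 0" using V is_subring_closed by blast
  define w where "w = inverse z"
  have "w \<in> V" using total z zV by (auto simp: w_def)
  hence w: "w \<in> nonunits V" using zV by (simp add: w_def nonunits_def)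
  have "1 = z ^ 3 * w ^ 3" using z0 by (simp add: w_def field_simps)
  also have "\<dots> = w * (p * w ^ 2 + q * w + r)"
    using z0 unfolding z(2) by (simp add: w_def field_simps power2_eq_square power3_eq_cube)
  also have "\<dots> \<in> nonunits V"
    using w \<open>w \<in> V\<close> c V by (intro nonunits_mult) (auto simp: is_subring_closed)
  finally show False using one_notin_nonunits by simp
qed

end

lemma valuation_ring_iff:
  assumes "is_subfield F"
  shows "valuation_ring K F V \<longleftrightarrow> valuation_subring F V \<and> K \<subset> V \<and> V \<subset> F"
  using assms by (auto simp: valuation_ring_def valuation_subring_def subring_type_algebra_iff)

text \<open>The factorization of all nonzero elements as a power of \<open>\<pi>\<close> times a unit is taken as the defining
  property; the valuation is derived from it.\<close>

locale dvr =
  fixes F V :: "'l::field set" and \<pi> :: 'l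
  assumes F: "is_subfield F" and V: "is_subring V" and VF: "V \<subseteq> F"
    and pi_mem: "\<pi> \<in> V" and inverse_pi: "inverse \<pi> \<notin> V"
    and decomp: "\<And>z. z \<in> F \<Longrightarrow> z \<noteq> 0 \<Longrightarrow> \<exists>n u. unit_in V u \<and> z = \<pi> powi n * u"
begin

lemma pi_nz: "\<pi> \<noteq> 0"
  using inverse_pi V by (metis inverse_zero is_subring_closed(2))

lemma pi_powi_mem_iff: "\<pi> powi n \<in> V \<longleftrightarrow> n \<ge> 0"
proof
  assume n: "\<pi> powi n \<in> V"
  show "n \<ge> 0"
  proof (rule ccontr)
    assume "\<not> n \<ge> 0"
    hence "\<pi> powi n * \<pi> ^ nat (- n - 1) = inverse \<pi>"
      using pi_nz by (simp flip: power_int_add power_int_of_nat power_int_minus)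
    thus False using n pi_mem inverse_pi V by (metis is_subring_closed(6,7))
  qed
next
  assume "n \<ge> 0"
  thus "\<pi> powi n \<in> V" using pi_mem V by (simp add: power_int_def is_subring_closed)
qed

lemma mem_iff:
  assumes u: "unit_in V u"
  shows "\<pi> powi n * u \<in> V \<longleftrightarrow> n \<ge> 0"
proof -
  have "\<pi> powi n * u \<in> V \<longleftrightarrow> \<pi> powi n \<in> V"
  proof
    assume "\<pi> powi n * u \<in> V"
    hence "\<pi> powi n * u * inverse u \<in> V" using u V by (auto simp: unit_in_def is_subring_closed)
    thus "\<pi> powi n \<in> V" using u by (simp add: unit_in_def mult.assoc)
  qed (use u V in \<open>auto simp: unit_in_def is_subring_closed\<close>)
  thus ?thesis by (simp add: pi_powi_mem_iff)
qed

lemma unit_iff: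
  assumes u: "unit_in V u"
  shows "unit_in V (\<pi> powi n * u) \<longleftrightarrow> n = 0"
proof -
  have "inverse (\<pi> powi n * u) = \<pi> powi (- n) * inverse u"
    by (simp add: power_int_minus)
  thus ?thesis
    using u pi_nz mem_iff[OF u, of n] mem_iff[OF unit_in_inverse[OF u], of "- n"]
    by (auto simp: unit_in_def)
qed

lemma nonunits_eq: "nonunits V = (\<lambda>z. \<pi> * z) ` V"
proof (intro equalityI subsetI)
  fix z assume z: "z \<in> nonunits V"
  show "z \<in> (\<lambda>z. \<pi> * z) ` V"
  proof (cases "z = 0")
    case True
    thus ?thesis using V is_subring_closed(2) by force
  next
    case False
    obtain n u where nu: "unit_in V u" "z = \<pi> powi n * u"
      using decomp[of z] False z VF by (auto simp: nonunits_def)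
    have "n \<ge> 0" using z nu mem_iff by (simp add: nonunits_def)
    moreover have "n \<noteq> 0" using z nu unit_iff[OF nu(1), of n] False by (auto simp: nonunits_def unit_in_def)
    ultimately have "z = \<pi> * (\<pi> powi (n - 1) * u)" "\<pi> powi (n - 1) * u \<in> V"
      using nu mem_iff[OF nu(1), of "n - 1"] pi_nz by (simp add: power_int_diff, simp)
    thus ?thesis by blast
  qed
next
  fix z assume "z \<in> (\<lambda>z. \<pi> * z) ` V"
  then obtain v where v: "z = \<pi> * v" "v \<in> V" by blast
  have "inverse \<pi> \<in> V" if "inverse z \<in> V" "z \<noteq> 0"
  proof -
    have "inverse \<pi> = inverse z * v" using v that by simp
    thus ?thesis using that v V by (metis is_subring_closed(6))
  qed
  thus "z \<in> nonunits V" using inverse_pi v V pi_mem by (auto simp: nonunits_def is_subring_closed)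
qed

lemma pi_nonunit: "\<pi> \<in> nonunits V"
  using pi_mem inverse_pi by (simp add: nonunits_def)

sublocale valuation_subring F V
proof
  fix z assume z: "z \<in> F"
  show "z \<in> V \<or> inverse z \<in> V"
  proof (cases "z = 0")
    case False
    then obtain n u where nu: "unit_in V u" "z = \<pi> powi n * u" using decomp z by blast
    have inv: "inverse z = \<pi> powi (- n) * inverse u" using nu(2) by (simp add: power_int_minus)
    thus ?thesis
      using mem_iff[OF nu(1), of n] mem_iff[OF unit_in_inverse[OF nu(1)], of "- n"]
      unfolding inv unfolding nu(2) by linarith
  qed (use V in \<open>auto simp: is_subring_closed\<close>)
qed (use F V VF in auto)

lemma valuation_ring:
  assumes "K \<subseteq> V" and "is_subfield K"
  shows "valuation_ring K F V"
proof -
  have "K \<noteq> V" using assms pi_mem inverse_pi is_subfield_closed(2) by blast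
  moreover have "V \<noteq> F" using F pi_mem inverse_pi is_subfield_closed(2) by blast
  ultimately show ?thesis
    using assms VF valuation_subring_axioms by (auto simp: valuation_ring_iff[OF F])
qed

lemma place_ring_eq_self: "place_ring F (nonunits V) = V"
  using V VF total
  by (auto simp: place_ring_def nonunits_def is_subring_closed)

lemma uniformizer_iff: "uniformizer F (nonunits V) s \<longleftrightarrow> (\<exists>u. unit_in V u \<and> s = \<pi> * u)"
proof
  assume s: "uniformizer F (nonunits V) s"
  hence "nonunits V = (\<lambda>z. s * z) ` V"
    by (simp only: uniformizer_def place_ring_eq_self)
  hence eq: "(\<lambda>z. \<pi> * z) ` V = (\<lambda>z. s * z) ` V"
    by (rule trans[OF nonunits_eq[symmetric]])
  have one: "1 \<in> V" using V by (simp add: is_subring_closed)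
  have "s * 1 \<in> (\<lambda>z. \<pi> * z) ` V" unfolding eq using one by blast
  then obtain v where v: "s = \<pi> * v" "v \<in> V" by auto
  have "\<pi> * 1 \<in> (\<lambda>z. s * z) ` V" unfolding eq[symmetric] using one by blast
  then obtain w where w: "\<pi> = s * w" "w \<in> V" by auto
  have "v * w = 1" using v w pi_nz by (metis mult.assoc mult.right_neutral mult_cancel_left)
  hence "unit_in V v" using v w by (auto simp: unit_in_def inverse_unique)
  thus "\<exists>u. unit_in V u \<and> s = \<pi> * u" using v by blast
next
  assume "\<exists>u. unit_in V u \<and> s = \<pi> * u"
  then obtain u where u: "unit_in V u" "s = \<pi> * u" by blast
  have "(\<lambda>z. u * z) ` V = V"
  proof (intro equalityI subsetI)
    fix z assume "z \<in> V"
    hence "inverse u * z \<in> V" "z = u * (inverse u * z)"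
      using u V by (auto simp: unit_in_def is_subring_closed)
    thus "z \<in> (\<lambda>z. u * z) ` V" by blast
  qed (use u V in \<open>auto simp: unit_in_def is_subring_closed\<close>)
  hence "(\<lambda>z. \<pi> * z) ` V = (\<lambda>z. s * z) ` V"
    using image_image[of "\<lambda>z. \<pi> * z" "\<lambda>z. u * z" V] by (simp add: u(2) mult.assoc)
  thus "uniformizer F (nonunits V) s"
    unfolding uniformizer_def place_ring_eq_self by (rule trans[OF nonunits_eq])
qed

text \<open>The value does not depend on the uniformizer chosen inside \<^const>\<open>place_val\<close>, because any two
  uniformizers differ by a unit.\<close>

lemma place_val_eq:
  assumes u: "unit_in V u"
  shows "place_val F (nonunits V) (\<pi> powi n * u) = n"
  unfolding place_val_def place_ring_eq_self
proof (rule the_equality)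
  show "\<exists>t v. uniformizer F (nonunits V) t \<and> v \<in> V \<and> v \<noteq> 0 \<and> inverse v \<in> V \<and>
      \<pi> powi n * u = t powi n * v"
    using u V by (intro exI[of _ \<pi>] exI[of _ u])
      (auto simp: uniformizer_iff unit_in_def is_subring_closed intro!: exI[of _ 1])
next
  fix m
  assume "\<exists>t v. uniformizer F (nonunits V) t \<and> v \<in> V \<and> v \<noteq> 0 \<and> inverse v \<in> V \<and>
      \<pi> powi n * u = t powi m * v"
  then obtain t v where t: "uniformizer F (nonunits V) t" "unit_in V v" "\<pi> powi n * u = t powi m * v"
    by (auto simp: unit_in_def)
  obtain w where w: "unit_in V w" "t = \<pi> * w" using t uniformizer_iff by blast
  have "\<pi> powi (n - m) * u = w powi m * v"
    using t w pi_nz by (simp add: power_int_diff power_int_mult_distrib field_simps)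
  moreover have "unit_in V (w powi m * v)" using w t V by (simp add: unit_in_mult unit_in_powi)
  ultimately show "m = n" using unit_iff[OF u, of "n - m"] by simp
qed

text \<open>A strictly larger subring contains some \<open>\<pi> powi n * u\<close> with \<open>n < 0\<close>, hence \<open>1 / \<pi>\<close>, hence
  everything.\<close>

lemma maximal:
  assumes W: "is_subring W" "W \<subset> F" "V \<subseteq> W"
  shows "W = V"
proof (rule ccontr)
  assume "W \<noteq> V"
  then obtain w where w: "w \<in> W" "w \<notin> V" using W by blast
  have "w \<noteq> 0" using w V is_subring_closed(2) by blast
  then obtain n u where nu: "unit_in V u" "w = \<pi> powi n * u" using decomp w W by blast
  have n: "n < 0" using w nu mem_iff[OF nu(1), of n] by simp
  have "\<pi> powi n * \<pi> ^ nat (- n - 1) = inverse \<pi>"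
    using pi_nz n by (simp flip: power_int_add power_int_of_nat power_int_minus)
  hence "inverse \<pi> = w * inverse u * \<pi> ^ nat (- n - 1)"
    using nu by (simp add: unit_in_def mult.assoc)
  moreover have "w * inverse u * \<pi> ^ nat (- n - 1) \<in> W"
    using w W nu pi_mem by (auto simp: unit_in_def intro!: is_subring_closed)
  ultimately have inv: "inverse \<pi> \<in> W" by simp
  have "F \<subseteq> W"
  proof
    fix z assume z: "z \<in> F"
    show "z \<in> W"
    proof (cases "z = 0")
      case False
      then obtain m v where mv: "unit_in V v" "z = \<pi> powi m * v" using decomp z by blast
      have "\<pi> powi m \<in> W"
        using inv pi_mem W by (auto simp: power_int_def intro!: is_subring_closed)
      thus ?thesis using mv W by (auto simp: unit_in_def intro!: is_subring_closed)
    qed (use W in \<open>auto simp: is_subring_closed\<close>)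
  qed
  thus False using W by blast
qed

end

section \<open>Ramification and splitting read off from valuation rings\<close>

text \<open>On \<open>t powi n * u\<close> the two valuations are \<open>n\<close> and \<open>e * n\<close>, and the value at \<open>t\<close> alone
  already determines \<open>e\<close>.\<close>

lemma ramification_index_eq:
  assumes EO: "dvr E A t" and FV: "dvr F V \<pi>" and "A \<subseteq> V" "unit_in V w" "t = \<pi> ^ e * w"
  shows "ramification_index E F (nonunits A) (nonunits V) = e"
proof -
  interpret EO: dvr E A t by fact
  interpret FV: dvr F V \<pi> by fact
  have val: "place_val F (nonunits V) (t powi n * u) = int e * n" if u: "unit_in A u" for n u
  proof -
    have "t powi n * u = \<pi> powi (int e * n) * (w powi n * u)"
      by (simp add: assms(5) power_int_mult_distrib power_int_power)
    moreover have "unit_in V (w powi n * u)"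
      using assms u by (intro unit_in_mult unit_in_powi FV.V) (auto simp: unit_in_mono)
    ultimately show ?thesis using FV.place_val_eq by presburger
  qed
  have one: "unit_in A 1" by (simp add: unit_in_def EO.V is_subring_closed)
  show ?thesis
    unfolding ramification_index_def
  proof (rule the_equality)
    show "\<forall>z\<in>E - {0}. place_val F (nonunits V) z = int e * place_val E (nonunits A) z"
      using EO.decomp val EO.place_val_eq by fastforce
  next
    fix e' assume *: "\<forall>z\<in>E - {0}. place_val F (nonunits V) z = int e' * place_val E (nonunits A) z"
    have "place_val F (nonunits V) t = int e' * place_val E (nonunits A) t"
      using * EO.pi_nz EO.pi_mem EO.VF by blast
    thus "e' = e" using val[OF one, of 1] EO.place_val_eq[OF one, of 1] by simp
  qed
qed

text \<open>A place determines its valuation ring and conversely, so a splitting can be computed with valuation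
  rings: each listed ring yields a place with ramification index \<open>e\<close>, distinct rings yield distinct
  places, and \<open>complete\<close> says that no ring above \<open>A\<close> has been missed.\<close>

lemma splits_asI:
  assumes EO: "dvr E A t" and K: "is_subfield K" "K \<subseteq> A"
    and pts: "\<And>V e. (V, e) \<in> set vs \<Longrightarrow> A \<subseteq> V \<and> (\<exists>\<pi> w. dvr F V \<pi> \<and> unit_in V w \<and> t = \<pi> ^ e * w)"
    and epos: "\<And>V e. (V, e) \<in> set vs \<Longrightarrow> e > 0"
    and dist: "distinct (map fst vs)"
    and complete: "\<And>W. valuation_ring K F W \<Longrightarrow> nonunits A \<subseteq> nonunits W \<Longrightarrow> W \<in> fst ` set vs"
  shows "splits_as K E F (nonunits A) (map (\<lambda>(V, e). (nonunits V, e)) vs)"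
proof -
  have val: "valuation_ring K F V" if "(V, e) \<in> set vs" for V e
    using pts[OF that] dvr.valuation_ring[of F V _ K] K by blast
  have inj: "inj_on nonunits (fst ` set vs)"
  proof (rule inj_onI)
    fix V W assume "V \<in> fst ` set vs" "W \<in> fst ` set vs" and eq: "nonunits V = nonunits W"
    hence "valuation_ring K F V" "valuation_ring K F W" using val by auto
    thus "V = W" using eq place_ring_nonunits by metis
  qed
  have fsts: "map fst (map (\<lambda>(V, e). (nonunits V, e)) vs) = map nonunits (map fst vs)"
    by (simp add: case_prod_unfold)
  have over: "nonunits A \<subseteq> nonunits V" if Ve: "(V, e) \<in> set vs" for V e
  proof -
    obtain \<pi> w where w: "dvr F V \<pi>" "unit_in V w" "t = \<pi> ^ e * w" and OV: "A \<subseteq> V" using pts[OF Ve] by blast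
    interpret dvr F V \<pi> by fact
    have "t = \<pi> * (\<pi> ^ (e - 1) * w)" using w epos[OF Ve] by (simp flip: power_Suc mult.assoc)
    moreover have "\<pi> ^ (e - 1) * w \<in> V" using w V pi_mem by (auto simp: unit_in_def is_subring_closed)
    ultimately have "t \<in> nonunits V" using nonunits_mult[OF pi_nonunit] by simp
    thus ?thesis using dvr.nonunits_eq[OF EO] nonunits_mult OV by auto
  qed
  have "fst ` set (map (\<lambda>(V, e). (nonunits V, e)) vs) = {P. place K F P \<and> lies_over P (nonunits A)}"
  proof (intro equalityI subsetI)
    fix P assume "P \<in> {P. place K F P \<and> lies_over P (nonunits A)}"
    then obtain W where W: "valuation_ring K F W" "P = nonunits W" "nonunits A \<subseteq> nonunits W"
      by (auto simp: place_iff lies_over_def)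
    thus "P \<in> fst ` set (map (\<lambda>(V, e). (nonunits V, e)) vs)"
      using complete[OF W(1,3)] by force
  next
    fix P assume "P \<in> fst ` set (map (\<lambda>(V, e). (nonunits V, e)) vs)"
    then obtain V e where "(V, e) \<in> set vs" "P = nonunits V" by auto
    thus "P \<in> {P. place K F P \<and> lies_over P (nonunits A)}"
      using val over unfolding place_iff lies_over_def by blast
  qed
  moreover have "distinct (map fst (map (\<lambda>(V, e). (nonunits V, e)) vs))"
    unfolding fsts distinct_map using dist inj by (simp add: distinct_map)
  moreover have "ramification_index E F (nonunits A) (nonunits V) = e" if "(V, e) \<in> set vs" for V e
    using pts[OF that] ramification_index_eq[OF EO] by blast
  ultimately show ?thesis unfolding splits_as_def by auto
qed

section \<open>Localizing an order at a point of its reduction\<close>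

text \<open>An order \<open>R\<close> in \<open>F\<close> with a homomorphism \<open>\<phi>\<close> to a field, whose kernel is generated by
  \<open>t\<close>, \<open>g\<close> and \<open>h\<close>. The last three assumptions speak about the localization at this kernel without
  mentioning it: there \<open>t\<close> is \<open>\<pi> ^ e\<close> up to a unit, and \<open>g\<close> and \<open>h\<close> are multiples of
  \<open>\<pi>\<close>. In other words, the maximal ideal of the localization is principal. Finiteness of the image
  stands in for maximality of the kernel, as a finite domain is a field.\<close>

locale residue_point =
  fixes F R :: "'l::field set" and \<phi> :: "'l \<Rightarrow> 'm::field" and t \<pi> g h :: 'l and e :: nat
  assumes F: "is_subfield F" and R: "is_subring R" and RF: "R \<subseteq> F"
    and phi_one: "\<phi> 1 = 1"
    and phi_add: "\<And>x y. x \<in> R \<Longrightarrow> y \<in> R \<Longrightarrow> \<phi> (x + y) = \<phi> x + \<phi> y"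
    and phi_mult: "\<And>x y. x \<in> R \<Longrightarrow> y \<in> R \<Longrightarrow> \<phi> (x * y) = \<phi> x * \<phi> y"
    and finite_residues: "finite (\<phi> ` R)"
    and t: "t \<in> R" "t \<noteq> 0" and clear: "\<And>z. z \<in> F \<Longrightarrow> \<exists>k. t ^ k * z \<in> R"
    and kernel: "\<And>x. x \<in> R \<Longrightarrow> \<phi> x = 0 \<Longrightarrow> \<exists>a\<in>R. \<exists>b\<in>R. \<exists>c\<in>R. x = t * a + g * b + h * c"
    and pi: "\<pi> \<in> R" "\<phi> \<pi> = 0" and e: "e > 0"
    and tpi: "\<exists>p q. p \<in> R \<and> q \<in> R \<and> \<phi> p \<noteq> 0 \<and> \<phi> q \<noteq> 0 \<and> t * q = \<pi> ^ e * p"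
    and gpi: "\<exists>p q. p \<in> R \<and> q \<in> R \<and> \<phi> q \<noteq> 0 \<and> g * q = \<pi> * p"
    and hpi: "\<exists>p q. p \<in> R \<and> q \<in> R \<and> \<phi> q \<noteq> 0 \<and> h * q = \<pi> * p"
begin

definition loc :: "'l set" where
  "loc = {p / q |p q. p \<in> R \<and> q \<in> R \<and> \<phi> q \<noteq> 0}"

lemma phi_zero: "\<phi> 0 = 0"
proof -
  have "\<phi> (0 + 0) = \<phi> 0 + \<phi> 0" using R by (intro phi_add) (auto simp: is_subring_closed)
  hence "\<phi> 0 = \<phi> 0 + \<phi> 0" by simp
  thus ?thesis by (metis add_cancel_left_right)
qed

lemma phi_minus: "x \<in> R \<Longrightarrow> \<phi> (- x) = - \<phi> x"
  using phi_add[of x "- x"] R phi_zero by (simp add: is_subring_closed eq_neg_iff_add_eq_0 add.commute)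

lemma phi_nz: "\<phi> q \<noteq> 0 \<Longrightarrow> q \<noteq> 0"
  using phi_zero by auto

lemma R_loc: "R \<subseteq> loc"
proof
  fix x assume "x \<in> R"
  thus "x \<in> loc" unfolding loc_def using R phi_one
    by (intro CollectI exI[of _ x] exI[of _ 1]) (auto simp: is_subring_closed)
qed

lemma locI: "p \<in> R \<Longrightarrow> q \<in> R \<Longrightarrow> \<phi> q \<noteq> 0 \<Longrightarrow> p / q \<in> loc"
  unfolding loc_def by blast

lemma subring_loc: "is_subring loc"
  unfolding is_subring_def
proof (intro conjI ballI)
  show "1 \<in> loc" using R_loc R is_subring_closed(1) by blast
  fix x y assume "x \<in> loc" "y \<in> loc"
  then obtain p q p' q' where *: "x = p / q" "p \<in> R" "q \<in> R" "\<phi> q \<noteq> 0"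
    "y = p' / q'" "p' \<in> R" "q' \<in> R" "\<phi> q' \<noteq> 0"
    unfolding loc_def by blast
  have qq: "q * q' \<in> R" "\<phi> (q * q') \<noteq> 0" using * R phi_mult by (auto simp: is_subring_closed)
  have "x - y = (p * q' - p' * q) / (q * q')" "x * y = (p * p') / (q * q')"
    using * phi_nz by (auto simp: field_simps)
  moreover have "p * q' - p' * q \<in> R" "p * p' \<in> R" using * R by (auto simp: is_subring_closed)
  ultimately show "x - y \<in> loc" "x * y \<in> loc" using locI qq by metis+
qed

lemma loc_F: "loc \<subseteq> F"
  unfolding loc_def using RF F is_subfield_closed(3) by blast

lemma unit_locI: "p \<in> R \<Longrightarrow> q \<in> R \<Longrightarrow> \<phi> p \<noteq> 0 \<Longrightarrow> \<phi> q \<noteq> 0 \<Longrightarrow> unit_in loc (p / q)"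
  using locI[of p q] locI[of q p] phi_nz by (auto simp: unit_in_def)

lemma t_eq: obtains w where "unit_in loc w" "t = \<pi> ^ e * w"
proof -
  obtain p q where pq: "p \<in> R" "q \<in> R" "\<phi> p \<noteq> 0" "\<phi> q \<noteq> 0" "t * q = \<pi> ^ e * p" using tpi by blast
  have "t = \<pi> ^ e * (p / q)" using pq phi_nz by (simp add: field_simps)
  thus ?thesis using that unit_locI pq by blast
qed

lemma pi_loc: "\<pi> \<in> loc" "\<pi> \<noteq> 0"
proof -
  show "\<pi> \<in> loc" using pi R_loc by blast
  show "\<pi> \<noteq> 0" using t_eq t e by (metis mult_zero_left zero_power)
qed

text \<open>A nonunit has its numerator in the kernel of \<open>\<phi>\<close>, whose generators are multiples of
  \<open>\<pi>\<close>.\<close>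

lemma unit_or_multiple:
  assumes "v \<in> loc"
  shows "unit_in loc v \<or> (\<exists>v'\<in>loc. v = \<pi> * v')"
proof -
  obtain p q where pq: "v = p / q" "p \<in> R" "q \<in> R" "\<phi> q \<noteq> 0" using assms unfolding loc_def by blast
  show ?thesis
  proof (cases "\<phi> p = 0")
    case True
    have mult: "\<exists>w\<in>loc. x = \<pi> * w" if ex: "\<exists>p q. p \<in> R \<and> q \<in> R \<and> \<phi> q \<noteq> 0 \<and> x * q = \<pi> * p" for x
    proof -
      obtain p q where pq: "p \<in> R" "q \<in> R" "\<phi> q \<noteq> 0" "x * q = \<pi> * p" using ex by blast
      have "x = \<pi> * (p / q)" using pq phi_nz by (simp add: field_simps)
      thus ?thesis using locI pq by blast
    qed
    obtain a b c where abc: "a \<in> R" "b \<in> R" "c \<in> R" "p = t * a + g * b + h * c"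
      using kernel True pq by blast
    obtain g' where g': "g' \<in> loc" "g = \<pi> * g'" using mult[OF gpi] by blast
    obtain h' where h': "h' \<in> loc" "h = \<pi> * h'" using mult[OF hpi] by blast
    obtain w where w: "unit_in loc w" "t = \<pi> ^ e * w" by (rule t_eq)
    define t' where "t' = \<pi> ^ (e - 1) * w"
    have t': "t' \<in> loc" "t = \<pi> * t'"
      using w e pi_loc subring_loc
      by (auto simp: t'_def unit_in_def is_subring_closed simp flip: power_Suc mult.assoc)
    have "v = \<pi> * ((t' * a + g' * b + h' * c) * (1 / q))"
      using pq abc g' h' t' by (simp add: algebra_simps add_divide_distrib)
    moreover have "1 / q \<in> loc" using locI pq R is_subring_closed(1) by blast
    hence "(t' * a + g' * b + h' * c) * (1 / q) \<in> loc"
      using t' g' h' abc R_loc subring_loc by (intro is_subring_closed(5,6)) auto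
    ultimately show ?thesis by blast
  qed (use unit_locI pq in auto)
qed

text \<open>Stripping factors \<open>\<pi>\<close> off \<open>v\<close> has to stop, since each of them uses up one factor of
  \<open>\<pi> ^ N\<close>.\<close>

lemma divisor_of_power:
  assumes "v \<in> loc" "v' \<in> loc" "v * v' = \<pi> ^ N * u" "unit_in loc u"
  shows "\<exists>n u. unit_in loc u \<and> v = \<pi> ^ n * u"
  using assms
proof (induction N arbitrary: v)
  case 0
  hence "inverse v = v' * inverse u" by (auto simp: unit_in_def field_simps)
  hence "unit_in loc v"
    using 0 subring_loc by (auto simp: unit_in_def is_subring_closed)
  thus ?case by (intro exI[of _ 0] exI[of _ v]) simp
next
  case (Suc N)
  from unit_or_multiple[OF Suc.prems(1)] show ?case
  proof
    assume "unit_in loc v"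
    thus ?case by (intro exI[of _ 0] exI[of _ v]) simp
  next
    assume "\<exists>w\<in>loc. v = \<pi> * w"
    then obtain w where w: "w \<in> loc" "v = \<pi> * w" by blast
    hence "w * v' = \<pi> ^ N * u" using Suc.prems pi_loc by (simp add: mult.assoc)
    then obtain n u where "unit_in loc u" "w = \<pi> ^ n * u" using Suc.IH w Suc.prems by blast
    thus ?case using w by (intro exI[of _ "Suc n"] exI[of _ u]) simp
  qed
qed

text \<open>Both \<open>z\<close> and \<open>1 / z\<close> are moved into \<open>R\<close> by a power of \<open>t\<close>. So \<open>t ^ k * z\<close>
  divides a power of \<open>t\<close>, which is a power of \<open>\<pi>\<close> up to a unit.\<close>

lemma dvr_loc: "dvr F loc \<pi>"
proof
  show "inverse \<pi> \<notin> loc"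
  proof
    assume "inverse \<pi> \<in> loc"
    then obtain p q where pq: "inverse \<pi> = p / q" "p \<in> R" "q \<in> R" "\<phi> q \<noteq> 0" unfolding loc_def by blast
    hence "q = \<pi> * p" using pi_loc phi_nz by (simp add: field_simps)
    thus False using pq pi phi_mult by simp
  qed
  fix z assume z: "z \<in> F" "z \<noteq> 0"
  obtain k where k: "t ^ k * z \<in> R" using clear z by blast
  obtain l where l: "t ^ l * inverse z \<in> R" using clear[of "inverse z"] z F is_subfield_closed(2) by blast
  obtain w where w: "unit_in loc w" "t = \<pi> ^ e * w" by (rule t_eq)
  have "(t ^ k * z) * (t ^ l * inverse z) = t ^ (k + l)" using z by (simp add: power_add)
  also have "\<dots> = \<pi> ^ (e * (k + l)) * w ^ (k + l)"
    by (simp add: w(2) power_mult_distrib power_mult)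
  finally obtain n u where nu: "unit_in loc u" "t ^ k * z = \<pi> ^ n * u"
    using divisor_of_power k l R_loc unit_in_power[OF subring_loc w(1)] by blast
  have "z = \<pi> ^ n * u * inverse (t ^ k)" using nu t by (simp add: field_simps)
  also have "\<dots> = \<pi> powi (int n - int (e * k)) * (u * inverse (w ^ k))"
  proof -
    have "\<pi> powi (int n - int (e * k)) = \<pi> ^ n / \<pi> ^ (e * k)"
      using pi_loc by (simp add: power_int_diff del: of_nat_mult)
    thus ?thesis unfolding w(2) by (simp add: power_mult_distrib power_mult divide_inverse)
  qed
  finally have "z = \<pi> powi (int n - int (e * k)) * (u * inverse (w ^ k))" .
  moreover have "unit_in loc (u * inverse (w ^ k))"
    using nu w subring_loc by (intro unit_in_mult unit_in_inverse unit_in_power)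
  ultimately show "\<exists>n u. unit_in loc u \<and> z = \<pi> powi n * u" by blast
qed (use F subring_loc loc_F pi_loc in auto)

text \<open>Two powers of \<open>\<phi> x\<close> coincide in the finite image.\<close>

lemma eventually_one:
  assumes x: "x \<in> R" "\<phi> x \<noteq> 0"
  shows "\<exists>N>0. \<phi> (x ^ N) = 1"
proof -
  have pow: "\<phi> (x ^ n) = \<phi> x ^ n" for n
    using x R by (induction n) (auto simp: phi_one phi_mult is_subring_closed)
  have "range (\<lambda>n. \<phi> (x ^ n)) \<subseteq> \<phi> ` R" using x R by (auto simp: is_subring_closed)
  hence "\<not> inj (\<lambda>n. \<phi> (x ^ n))" using finite_residues finite_subset finite_imageD infinite_UNIV_nat by metis
  then obtain m n where mn: "m < n" "\<phi> x ^ m = \<phi> x ^ n"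
    unfolding inj_def pow by (metis linorder_neqE_nat)
  hence "\<phi> x ^ m * \<phi> x ^ (n - m) = \<phi> x ^ m * 1" by (subst power_add[symmetric]) simp
  hence "\<phi> (x ^ (n - m)) = 1" using x pow by simp
  thus ?thesis using mn by (intro exI[of _ "n - m"]) simp
qed

text \<open>The maximal ideal of \<open>W\<close> contains the kernel of \<open>\<phi>\<close>. It contains no other element of
  \<open>R\<close>: if \<open>\<phi> x \<noteq> 0\<close>, some power of \<open>x\<close> is congruent to \<open>1\<close> modulo the kernel. Hence \<open>W\<close>
  contains the localization, and a discrete valuation ring is a maximal proper subring.\<close>

lemma loc_unique:
  assumes W: "valuation_subring F W" "W \<subset> F" "R \<subseteq> W"
    and tgh: "t \<in> nonunits W" "g \<in> nonunits W" "h \<in> nonunits W"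
  shows "W = loc"
proof (rule dvr.maximal[OF dvr_loc])
  interpret W: valuation_subring F W by fact
  have ker: "x \<in> nonunits W" if "x \<in> R" "\<phi> x = 0" for x
    using kernel[OF that] tgh W(3) by (auto intro!: W.nonunits_add W.nonunits_mult)
  have unit: "unit_in W x" if x: "x \<in> R" "\<phi> x \<noteq> 0" for x
  proof (rule ccontr)
    assume "\<not> unit_in W x"
    hence xW: "x \<in> nonunits W" using x W phi_nz by (auto simp: unit_in_def nonunits_def)
    obtain N where N: "N > 0" "\<phi> (x ^ N) = 1" using eventually_one[OF x] by blast
    have xN: "x ^ N \<in> R" using x R by (simp add: is_subring_closed)
    have "\<phi> (1 + - (x ^ N)) = 0"
      using N xN R by (simp add: phi_add phi_minus phi_one is_subring_closed del: add_uminus_conv_diff)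
    hence "1 + - (x ^ N) \<in> nonunits W" using ker xN R by (simp add: is_subring_closed del: add_uminus_conv_diff)
    moreover have "x ^ N \<in> nonunits W"
      using N W.nonunits_mult[OF xW, of "x ^ (N - 1)"] x W by (auto simp: W.V is_subring_closed simp flip: power_Suc)
    ultimately have "1 + - (x ^ N) + x ^ N \<in> nonunits W" by (rule W.nonunits_add)
    thus False using W.one_notin_nonunits by simp
  qed
  show "loc \<subseteq> W"
  proof
    fix z assume "z \<in> loc"
    then obtain p q where pq: "z = p / q" "p \<in> R" "q \<in> R" "\<phi> q \<noteq> 0" unfolding loc_def by blast
    thus "z \<in> W" using unit[of q] W by (auto simp: unit_in_def divide_inverse W.V is_subring_closed)
  qed
  show "is_subring W" by (rule W.V)
qed (use W in auto)

lemma unit_in_loc_iff: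
  assumes "x \<in> R"
  shows "unit_in loc x \<longleftrightarrow> \<phi> x \<noteq> 0"
proof
  assume "unit_in loc x"
  then obtain p q where pq: "inverse x = p / q" "p \<in> R" "q \<in> R" "\<phi> q \<noteq> 0" "x \<noteq> 0"
    unfolding unit_in_def loc_def by blast
  hence "q = x * p" using phi_nz by (auto simp: field_simps)
  thus "\<phi> x \<noteq> 0" using pq assms phi_mult by auto
next
  assume "\<phi> x \<noteq> 0"
  thus "unit_in loc x" using unit_locI[of x 1] assms R phi_one by (simp add: is_subring_closed)
qed

end

section \<open>Cubic extensions of a subfield\<close>

definition span3 :: "'a::field set \<Rightarrow> 'a \<Rightarrow> 'a \<Rightarrow> 'a set" where
  "span3 S u v = {a + b * u + c * v |a b c. a \<in> S \<and> b \<in> S \<and> c \<in> S}"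

lemma span3I: "a \<in> S \<Longrightarrow> b \<in> S \<Longrightarrow> c \<in> S \<Longrightarrow> z = a + b * u + c * v \<Longrightarrow> z \<in> span3 S u v"
  unfolding span3_def by blast

lemma span3E:
  assumes "z \<in> span3 S u v"
  obtains a b c where "a \<in> S" "b \<in> S" "c \<in> S" "z = a + b * u + c * v"
  using assms unfolding span3_def by blast

lemma subring_span3:
  assumes S: "is_subring S"
    and mult: "u * u \<in> span3 S u v" "u * v \<in> span3 S u v" "v * v \<in> span3 S u v"
  shows "is_subring (span3 S u v)"
proof -
  note cl = is_subring_closed[OF S]
  have add: "x + y \<in> span3 S u v" if xy: "x \<in> span3 S u v" "y \<in> span3 S u v" for x y
  proof -
    obtain a b c where x: "a \<in> S" "b \<in> S" "c \<in> S" "x = a + b * u + c * v"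
      using xy(1) by (rule span3E)
    obtain a' b' c' where y: "a' \<in> S" "b' \<in> S" "c' \<in> S" "y = a' + b' * u + c' * v"
      using xy(2) by (rule span3E)
    from x y show ?thesis by (intro span3I[of "a + a'" _ "b + b'" "c + c'"]) (auto simp: cl algebra_simps)
  qed
  have scale: "s * x \<in> span3 S u v" if sx: "s \<in> S" "x \<in> span3 S u v" for s x
  proof -
    obtain a b c where "a \<in> S" "b \<in> S" "c \<in> S" "x = a + b * u + c * v" using sx(2) by (rule span3E)
    thus ?thesis using sx(1) by (intro span3I[of "s * a" _ "s * b" "s * c"]) (auto simp: cl algebra_simps)
  qed
  have u: "u \<in> span3 S u v" by (rule span3I[of 0 _ 1 0]) (auto simp: cl)
  have v: "v \<in> span3 S u v" by (rule span3I[of 0 _ 0 1]) (auto simp: cl)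
  have one: "1 \<in> span3 S u v" by (rule span3I[of 1 _ 0 0]) (auto simp: cl)
  have "x * y \<in> span3 S u v" if xy: "x \<in> span3 S u v" "y \<in> span3 S u v" for x y
  proof -
    obtain a b c where x: "a \<in> S" "b \<in> S" "c \<in> S" "x = a + b * u + c * v"
      using xy(1) by (rule span3E)
    obtain a' b' c' where y: "a' \<in> S" "b' \<in> S" "c' \<in> S" "y = a' + b' * u + c' * v"
      using xy(2) by (rule span3E)
    note * = x y
    have "x * y = (a * a') * 1 + (a * b' + b * a') * u + (a * c' + c * a') * v
        + (b * b') * (u * u) + (b * c' + c * b') * (u * v) + (c * c') * (v * v)"
      using * by (simp add: algebra_simps)
    also have "\<dots> \<in> span3 S u v"
      using * by (intro add scale mult one u v) (auto simp: cl)
    finally show ?thesis .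
  qed
  moreover have "x - y \<in> span3 S u v" if "x \<in> span3 S u v" "y \<in> span3 S u v" for x y
    using add[OF that(1) scale[of "- 1", OF _ that(2)]] cl by simp
  ultimately show ?thesis using one by (simp add: is_subring_def)
qed

locale cubic_over =
  fixes S :: "'a::field set" and a b y :: 'a
  assumes S: "is_subfield S" and ab: "a \<in> S" "b \<in> S" and y: "y ^ 3 = a * y - b"
    and no_root: "\<And>s. s \<in> S \<Longrightarrow> s ^ 3 \<noteq> a * s - b"
begin

lemmas closed = is_subring_closed[OF is_subfield_closed(1)[OF S]] is_subfield_closed(2,3)[OF S] ab

lemma indep_linear:
  assumes "u \<in> S" "v \<in> S" "u + v * y = 0"
  shows "u = 0 \<and> v = 0"
proof (cases "v = 0")
  case False
  hence "y = - u / v" using assms by (simp add: field_simps add_eq_0_iff)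
  hence "y \<in> S" using assms closed by auto
  thus ?thesis using no_root y by blast
qed (use assms in auto)

text \<open>A relation \<open>y ^ 2 = p * y + s\<close> makes \<open>y\<close> a zero of the remainder of \<open>T ^ 3 - a * T + b\<close>
  modulo \<open>T ^ 2 - p * T - s\<close>, which is linear. So this remainder vanishes, and the quotient \<open>T + p\<close>
  gives the root \<open>- p\<close> in \<open>S\<close>.\<close>

lemma indep:
  assumes c: "u \<in> S" "v \<in> S" "w \<in> S" "u + v * y + w * y ^ 2 = 0"
  shows "u = 0 \<and> v = 0 \<and> w = 0"
proof (cases "w = 0")
  case False
  define p s where "p = - v / w" and "s = - u / w"
  have ps: "p \<in> S" "s \<in> S" using c closed by (auto simp: p_def s_def)
  have y2: "y ^ 2 = p * y + s" using c(4) False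
    by (simp add: p_def s_def field_simps) (simp add: add_eq_0_iff algebra_simps)
  have "a * y - b = y * y ^ 2" by (simp add: power3_eq_cube power2_eq_square flip: y)
  also have "\<dots> = p * y ^ 2 + s * y" by (subst y2) (simp add: algebra_simps power2_eq_square)
  also have "\<dots> = p * (p * y + s) + s * y" by (simp only: y2)
  also have "\<dots> = (p ^ 2 + s) * y + p * s" by (simp add: algebra_simps power2_eq_square)
  finally have "(p * s + b) + (p ^ 2 + s - a) * y = 0" by (simp add: algebra_simps)
  hence "p * s + b = 0 \<and> p ^ 2 + s - a = 0" using ps closed by (intro indep_linear) auto
  hence ba: "b = - (p * s)" "a = p ^ 2 + s" by (auto simp: eq_neg_iff_add_eq_0 add.commute)
  have "(- p) ^ 3 = a * (- p) - b"
    unfolding ba by (simp add: power3_eq_cube power2_eq_square algebra_simps)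
  thus ?thesis using no_root[of "- p"] ps closed by blast
qed (use assms indep_linear in auto)

lemma subring_span: "is_subring (span3 S y (y ^ 2))"
proof (rule subring_span3)
  show "is_subring S" using S is_subfield_closed by blast
  show "y * y \<in> span3 S y (y ^ 2)"
    by (rule span3I[of 0 _ 0 1]) (auto simp: closed power2_eq_square)
  show "y * y ^ 2 \<in> span3 S y (y ^ 2)"
    by (rule span3I[of "- b" _ a 0]) (auto simp: closed y simp flip: power_Suc eval_nat_numeral)
  have "y ^ 2 * y ^ 2 = y * y ^ 3" by (simp add: eval_nat_numeral)
  also have "\<dots> = 0 + (- b) * y + a * y ^ 2" unfolding y by (simp add: algebra_simps power2_eq_square)
  finally show "y ^ 2 * y ^ 2 \<in> span3 S y (y ^ 2)"
    by (intro span3I[of 0 _ "- b" a]) (auto simp: closed)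
qed

text \<open>Division of the cubic by \<open>T + e\<close> leaves its value at \<open>- e\<close>, so \<open>y + e\<close> times the
  quotient is a nonzero constant.\<close>

lemma inverse_linear:
  assumes c: "u \<in> S" "v \<in> S"
  shows "inverse (u + v * y) \<in> span3 S y (y ^ 2)"
proof (cases "v = 0")
  case True
  thus ?thesis using c closed by (intro span3I[of "inverse u" _ 0 0]) auto
next
  case False
  define e where "e = u / v"
  have e: "e \<in> S" using c closed by (simp add: e_def)
  \<comment> \<open>minus the value of the cubic at \<open>- e\<close>\<close>
  define n where "n = e ^ 3 - a * e - b"
  have n: "n \<noteq> 0"
  proof
    assume "n = 0"
    hence "(- e) ^ 3 = a * (- e) - b" by (simp add: n_def algebra_simps)
    thus False using no_root e closed by blast
  qed
  have "(y + e) * (y ^ 2 - e * y + (e ^ 2 - a)) = y ^ 3 - a * y + e ^ 3 - a * e"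
    by (simp add: algebra_simps power2_eq_square power3_eq_cube)
  also have "\<dots> = n" by (simp add: y n_def)
  finally have "(u + v * y) * ((y ^ 2 - e * y + (e ^ 2 - a)) / (v * n)) = 1"
    using False n by (simp add: e_def field_simps)
  hence "inverse (u + v * y) = (y ^ 2 - e * y + (e ^ 2 - a)) / (v * n)"
    by (rule inverse_unique)
  also have "\<dots> = (e ^ 2 - a) / (v * n) + (- e / (v * n)) * y + (1 / (v * n)) * y ^ 2"
    by (simp add: diff_divide_distrib add_divide_distrib)
  finally show ?thesis
    by (rule span3I[rotated 3]) (auto simp: n_def intro!: closed c e)
qed

text \<open>Multiplication by \<open>y + p\<close> turns \<open>y ^ 2 - p * y - s\<close> into a linear expression, which has already
  been inverted.\<close>

lemma subfield_span: "is_subfield (span3 S y (y ^ 2))"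
  unfolding is_subfield_def
proof (intro conjI ballI)
  show "is_subring (span3 S y (y ^ 2))" by (rule subring_span)
  note cl = is_subring_closed[OF this]
  fix z assume "z \<in> span3 S y (y ^ 2)"
  then obtain u v w where z: "u \<in> S" "v \<in> S" "w \<in> S" "z = u + v * y + w * y ^ 2" by (rule span3E)
  show "inverse z \<in> span3 S y (y ^ 2)"
  proof (cases "w = 0 \<or> z = 0")
    case True
    thus ?thesis using z inverse_linear[of u v] cl by auto
  next
    case False
    define p s where "p = - v / w" and "s = - u / w"
    have ps: "p \<in> S" "s \<in> S" using z closed by (auto simp: p_def s_def)
    have "z * (y + p) = w * (y ^ 2 - p * y - s) * (y + p)"
      using z False by (simp add: p_def s_def field_simps)
    also have "\<dots> = w * (y ^ 3 - p ^ 2 * y - s * y - p * s)"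
      by (simp add: algebra_simps power2_eq_square power3_eq_cube)
    also have "\<dots> = (- w * (b + p * s)) + w * (a - p ^ 2 - s) * y"
      unfolding y by (simp add: algebra_simps)
    finally have *: "z * (y + p) = (- w * (b + p * s)) + w * (a - p ^ 2 - s) * y" .
    have "y + p \<noteq> 0" using indep_linear[of p 1] ps closed by (auto simp: add.commute)
    hence "inverse z = (y + p) * inverse (z * (y + p))" using False by simp
    moreover have "inverse (z * (y + p)) \<in> span3 S y (y ^ 2)"
      unfolding * by (intro inverse_linear closed z ps)
    moreover have "y + p \<in> span3 S y (y ^ 2)"
      using ps closed by (intro span3I[of p _ 1 0]) auto
    ultimately show ?thesis by (metis cl(6))
  qed
qed

lemma generate_field_eq: "generate_field ring_of_type_algebra (insert y S) = span3 S y (y ^ 2)"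
proof (intro equalityI subsetI)
  note cl = is_subring_closed[OF subring_span] is_subfield_closed(2)[OF subfield_span]
  fix z assume "z \<in> generate_field ring_of_type_algebra (insert y S)"
  thus "z \<in> span3 S y (y ^ 2)"
  proof induction
    case (incl h)
    thus ?case using span3I[of h S 0 0 h y "y ^ 2"] span3I[of 0 S 1 0 y y "y ^ 2"] closed by auto
  next
    case (m_inv h)
    hence "h \<noteq> 0" by (simp add: ring_of_type_algebra_def)
    thus ?case using m_inv cl by (simp add: m_inv_type_algebra)
  next
    case (a_inv h)
    thus ?case using cl by (simp add: a_inv_type_algebra)
  qed (auto simp: ring_of_type_algebra_def cl)
next
  let ?G = "generate_field ring_of_type_algebra (insert y S)"
  have add: "p + q \<in> ?G" and mult: "p * q \<in> ?G" if "p \<in> ?G" "q \<in> ?G" for p q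
    using generate_field.eng_add[OF that] generate_field.eng_mult[OF that]
    by (simp_all add: ring_of_type_algebra_def)
  have inc: "p \<in> ?G" if "p \<in> insert y S" for p using that by (rule generate_field.incl)
  fix z assume "z \<in> span3 S y (y ^ 2)"
  then obtain u v w where "u \<in> S" "v \<in> S" "w \<in> S" "z = u + v * y + w * y ^ 2" by (rule span3E)
  thus "z \<in> ?G" unfolding power2_eq_square by (simp only:) (intro add mult inc; simp)
qed

end

section \<open>The ring of a binary cubic form\<close>

text \<open>\<open>A\<close> is a discrete valuation ring of \<open>E\<close> with uniformizer \<open>t\<close>, residue map \<open>res\<close>, and
  representatives of all residue classes in the subfield \<open>K\<close>; \<open>\<theta>\<close> generates the cubic extension
  \<open>F\<close>. The leading coefficient \<open>\<tau>\<close> of the equation of \<open>\<theta>\<close> may be a nonunit, so that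
  \<open>\<theta>\<close> need not be integral: the roots of the reduced equation are to be counted on the projective line,
  as zeros of the binary form \<open>\<tau> X\<^sup>3 - \<alpha> X Y\<^sup>2 + \<beta> Y\<^sup>3\<close>. The residue map takes values in
  an arbitrary field, which may be larger than the residue field, so that it can contain all these
  roots.\<close>

locale cubic_order =
  fixes E A F K :: "'l::field set" and t \<theta> \<tau> \<alpha> \<beta> :: 'l and res :: "'l \<Rightarrow> 'm::field"
  assumes base: "dvr E A t" and K: "is_subfield K" "K \<subseteq> A"
    and F: "is_subfield F" "F = span3 E \<theta> (\<theta> ^ 2)"
    and indep: "\<And>u v w. u \<in> E \<Longrightarrow> v \<in> E \<Longrightarrow> w \<in> E \<Longrightarrow> u + v * \<theta> + w * \<theta> ^ 2 = 0 \<Longrightarrow>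
      u = 0 \<and> v = 0 \<and> w = 0"
    and coeffs: "\<tau> \<in> A" "\<alpha> \<in> A" "\<beta> \<in> A" "\<tau> \<noteq> 0" and cubic: "\<tau> * \<theta> ^ 3 = \<alpha> * \<theta> - \<beta>"
    and res_one: "res 1 = 1"
    and res_add: "\<And>x y. x \<in> A \<Longrightarrow> y \<in> A \<Longrightarrow> res (x + y) = res x + res y"
    and res_mult: "\<And>x y. x \<in> A \<Longrightarrow> y \<in> A \<Longrightarrow> res (x * y) = res x * res y"
    and res_eq_0: "\<And>x. x \<in> A \<Longrightarrow> res x = 0 \<longleftrightarrow> x \<in> nonunits A"
    and finite_res: "finite (res ` A)"
    and const_part: "\<And>x. x \<in> A \<Longrightarrow> \<exists>c\<in>K. x - c \<in> nonunits A"
begin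

sublocale base: dvr E A t by (rule base)

lemmas A_closed = is_subring_closed[OF base.V] coeffs(1-3) base.pi_mem

text \<open>With \<open>1\<close>, these two elements span the ring that Delone and Faddeev attach to the binary cubic form.
  They are integral even where \<open>\<theta>\<close> is not.\<close>

definition "e1 = \<tau> * \<theta>"
definition "e2 = \<tau> * \<theta> ^ 2"

lemma table: "e1 * e1 = \<tau> * e2" "e1 * e2 = \<alpha> * e1 - \<tau> * \<beta>" "e2 * e2 = \<alpha> * e2 - \<beta> * e1"
proof -
  show "e1 * e1 = \<tau> * e2" by (simp add: e1_def e2_def power2_eq_square)
  have "e1 * e2 = \<tau> * (\<tau> * \<theta> ^ 3)" by (simp add: e1_def e2_def power2_eq_square power3_eq_cube)
  thus "e1 * e2 = \<alpha> * e1 - \<tau> * \<beta>" unfolding cubic by (simp add: e1_def algebra_simps)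
  have "e2 * e2 = \<tau> * \<theta> * (\<tau> * \<theta> ^ 3)" by (simp add: e2_def power2_eq_square power3_eq_cube)
  thus "e2 * e2 = \<alpha> * e2 - \<beta> * e1" unfolding cubic by (simp add: e1_def e2_def algebra_simps power2_eq_square)
qed

definition R :: "'l set" where "R = span3 A e1 e2"

lemma subring_R: "is_subring R"
  unfolding R_def
proof (rule subring_span3)
  show "e1 * e1 \<in> span3 A e1 e2" by (rule span3I[of 0 _ 0 \<tau>]) (auto simp: A_closed table)
  show "e1 * e2 \<in> span3 A e1 e2"
    by (rule span3I[of "- (\<tau> * \<beta>)" _ \<alpha> 0]) (auto simp: table intro!: A_closed)
  show "e2 * e2 \<in> span3 A e1 e2" by (rule span3I[of 0 _ "- \<beta>" \<alpha>]) (auto simp: A_closed table)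
qed (rule base.V)

lemmas R_closed = is_subring_closed[OF subring_R]

lemma A_R: "A \<subseteq> R" and e1_R: "e1 \<in> R" and e2_R: "e2 \<in> R"
proof -
  show "A \<subseteq> R" unfolding R_def by (auto intro: span3I[of _ _ 0 0] simp: A_closed)
  show "e1 \<in> R" unfolding R_def by (rule span3I[of 0 _ 1 0]) (auto simp: A_closed)
  show "e2 \<in> R" unfolding R_def by (rule span3I[of 0 _ 0 1]) (auto simp: A_closed)
qed

lemma R_F: "R \<subseteq> F"
proof
  fix z assume "z \<in> R"
  then obtain a b c where "a \<in> A" "b \<in> A" "c \<in> A" "z = a + b * e1 + c * e2" unfolding R_def by (rule span3E)
  moreover have "b * \<tau> \<in> E" "c * \<tau> \<in> E" "a \<in> E" using calculation by (auto intro!: subsetD[OF base.VF] simp: A_closed)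
  ultimately show "z \<in> F" unfolding F(2)
    by (intro span3I[of a _ "b * \<tau>" "c * \<tau>"]) (auto simp: e1_def e2_def)
qed

lemma coords_unique:
  assumes "a \<in> A" "b \<in> A" "c \<in> A" "a' \<in> A" "b' \<in> A" "c' \<in> A"
    and "a + b * e1 + c * e2 = a' + b' * e1 + c' * e2"
  shows "a = a' \<and> b = b' \<and> c = c'"
proof -
  have "(a - a') + ((b - b') * \<tau>) * \<theta> + ((c - c') * \<tau>) * \<theta> ^ 2 = 0"
    using assms(7) by (simp add: e1_def e2_def algebra_simps)
  moreover have "a - a' \<in> E" "(b - b') * \<tau> \<in> E" "(c - c') * \<tau> \<in> E"
    using assms(1-6) by (auto intro!: subsetD[OF base.VF] simp: A_closed)
  ultimately have "a - a' = 0 \<and> (b - b') * \<tau> = 0 \<and> (c - c') * \<tau> = 0" using indep by blast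
  thus ?thesis using coeffs by simp
qed

text \<open>Reduction of the coordinates modulo \<open>t\<close>, followed by \<open>e1 \<mapsto> c1\<close> and \<open>e2 \<mapsto> c2\<close>.\<close>

definition phi :: "'m \<Rightarrow> 'm \<Rightarrow> 'l \<Rightarrow> 'm" where
  "phi c1 c2 x = (THE w. \<exists>a\<in>A. \<exists>b\<in>A. \<exists>c\<in>A. x = a + b * e1 + c * e2 \<and> w = res a + res b * c1 + res c * c2)"

lemma phi_eq:
  assumes "a \<in> A" "b \<in> A" "c \<in> A"
  shows "phi c1 c2 (a + b * e1 + c * e2) = res a + res b * c1 + res c * c2"
  unfolding phi_def
proof (rule the_equality)
  fix w assume "\<exists>a'\<in>A. \<exists>b'\<in>A. \<exists>c'\<in>A. a + b * e1 + c * e2 = a' + b' * e1 + c' * e2 \<and>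
      w = res a' + res b' * c1 + res c' * c2"
  then obtain a' b' c' where *: "a' \<in> A" "b' \<in> A" "c' \<in> A" "a + b * e1 + c * e2 = a' + b' * e1 + c' * e2"
      "w = res a' + res b' * c1 + res c' * c2" by blast
  show "w = res a + res b * c1 + res c * c2"
    using coords_unique[OF assms *(1-4)] *(5) by simp
qed (use assms in blast)

lemma res_zero: "res 0 = 0"
  using res_eq_0[of 0] A_closed by (auto simp: nonunits_def)

lemma res_minus: "x \<in> A \<Longrightarrow> res (- x) = - res x"
  using res_add[of x "- x"] res_zero A_closed by (simp add: eq_neg_iff_add_eq_0 add.commute)

lemma res_diff: "x \<in> A \<Longrightarrow> y \<in> A \<Longrightarrow> res (x - y) = res x - res y"
  using res_add[of x "- y"] res_minus[of y] A_closed by simp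

lemma phi_A: "a \<in> A \<Longrightarrow> phi c1 c2 a = res a"
  and phi_e1: "phi c1 c2 e1 = c1" and phi_e2: "phi c1 c2 e2 = c2"
proof -
  show "a \<in> A \<Longrightarrow> phi c1 c2 a = res a" using phi_eq[of a 0 0 c1 c2] by (simp add: A_closed res_zero)
  show "phi c1 c2 e1 = c1" using phi_eq[of 0 1 0 c1 c2] by (simp add: A_closed res_zero res_one)
  show "phi c1 c2 e2 = c2" using phi_eq[of 0 0 1 c1 c2] by (simp add: A_closed res_zero res_one)
qed

text \<open>The multiplication table of the ring modulo \<open>t\<close>, which makes \<^term>\<open>phi c1 c2\<close> a homomorphism. A root
  \<open>c\<close> of the reduced equation gives the solution \<open>c1 = res \<tau> * c\<close>, \<open>c2 = res \<tau> * c ^ 2\<close>. If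
  \<open>res \<tau> = 0\<close>, the reduced form also vanishes at infinity, and this zero gives
  \<open>c1 = 0\<close>, \<open>c2 = res \<alpha>\<close>.\<close>

definition reduced_zero :: "'m \<Rightarrow> 'm \<Rightarrow> bool" where
  "reduced_zero c1 c2 \<longleftrightarrow> c1 * c1 = res \<tau> * c2 \<and> c1 * c2 = res \<alpha> * c1 - res \<tau> * res \<beta> \<and>
     c2 * c2 = res \<alpha> * c2 - res \<beta> * c1"

lemma phi_add:
  assumes "x \<in> R" "y \<in> R"
  shows "phi c1 c2 (x + y) = phi c1 c2 x + phi c1 c2 y"
proof -
  obtain a b c where x: "a \<in> A" "b \<in> A" "c \<in> A" "x = a + b * e1 + c * e2"
    using assms unfolding R_def by (auto elim!: span3E)
  obtain a' b' c' where y: "a' \<in> A" "b' \<in> A" "c' \<in> A" "y = a' + b' * e1 + c' * e2"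
    using assms unfolding R_def by (auto elim!: span3E)
  note * = x y
  have sum: "x + y = (a + a') + (b + b') * e1 + (c + c') * e2" using * by (simp add: algebra_simps)
  have "phi c1 c2 (x + y) = res (a + a') + res (b + b') * c1 + res (c + c') * c2"
    unfolding sum using * by (intro phi_eq) (simp_all add: A_closed)
  also have "\<dots> = phi c1 c2 x + phi c1 c2 y"
    unfolding *(4,8) phi_eq[OF *(1-3)] phi_eq[OF *(5-7)] using * by (simp add: res_add algebra_simps)
  finally show ?thesis .
qed

lemma phi_mult:
  assumes c: "reduced_zero c1 c2" and "x \<in> R" "y \<in> R"
  shows "phi c1 c2 (x * y) = phi c1 c2 x * phi c1 c2 y"
proof -
  obtain a b c where x: "a \<in> A" "b \<in> A" "c \<in> A" "x = a + b * e1 + c * e2"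
    using assms unfolding R_def by (auto elim!: span3E)
  obtain a' b' c' where y: "a' \<in> A" "b' \<in> A" "c' \<in> A" "y = a' + b' * e1 + c' * e2"
    using assms unfolding R_def by (auto elim!: span3E)
  note * = x y
  define s where "s = b * c' + c * b'"
  have s: "s \<in> A" using * A_closed by (simp add: s_def)
  have res_s: "res s = res b * res c' + res c * res b'"
    using * by (simp add: s_def A_closed res_add res_mult)
  have "x * y = a * a' + (a * b' + b * a') * e1 + (a * c' + c * a') * e2
      + (b * b') * (e1 * e1) + s * (e1 * e2) + (c * c') * (e2 * e2)"
    using * by (simp add: s_def algebra_simps)
  also have "\<dots> = (a * a' - s * (\<tau> * \<beta>)) + (a * b' + b * a' + s * \<alpha> - c * c' * \<beta>) * e1
      + (a * c' + c * a' + b * b' * \<tau> + c * c' * \<alpha>) * e2"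
    unfolding table by (simp add: algebra_simps)
  finally have "phi c1 c2 (x * y) = res (a * a' - s * (\<tau> * \<beta>))
      + res (a * b' + b * a' + s * \<alpha> - c * c' * \<beta>) * c1
      + res (a * c' + c * a' + b * b' * \<tau> + c * c' * \<alpha>) * c2"
    using * s by (simp add: phi_eq A_closed)
  also have "\<dots> = res a * res a' + (res a * res b' + res b * res a') * c1 + (res a * res c' + res c * res a') * c2
      + (res b * res b') * (res \<tau> * c2) + res s * (res \<alpha> * c1 - res \<tau> * res \<beta>)
      + (res c * res c') * (res \<alpha> * c2 - res \<beta> * c1)"
    using * s by (simp add: A_closed res_add res_diff res_mult algebra_simps)
  also have "\<dots> = res a * res a' + (res a * res b' + res b * res a') * c1 + (res a * res c' + res c * res a') * c2
      + (res b * res b') * (c1 * c1) + res s * (c1 * c2) + (res c * res c') * (c2 * c2)"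
    using c by (simp add: reduced_zero_def)
  also have "\<dots> = phi c1 c2 x * phi c1 c2 y"
    unfolding *(4,8) phi_eq[OF *(1-3)] phi_eq[OF *(5-7)] res_s by (simp add: algebra_simps)
  finally show ?thesis .
qed

lemma clear_denominator: "x \<in> E \<Longrightarrow> \<exists>k. \<forall>n\<ge>k. t ^ n * x \<in> A"
proof (cases "x = 0")
  case False
  assume "x \<in> E"
  then obtain n u where nu: "unit_in A u" "x = t powi n * u" using base.decomp False by blast
  have "t ^ m * x \<in> A" if "m \<ge> nat (- n)" for m
  proof -
    have "t ^ m * x = t powi (int m + n) * u" using nu base.pi_nz by (simp add: power_int_add)
    thus ?thesis using base.mem_iff[OF nu(1), of "int m + n"] that by simp
  qed
  thus ?thesis by blast
qed (use A_closed in auto)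

text \<open>All global conditions on a residue point hold automatically; generators of the kernel and a local
  uniformizer remain to be given.\<close>

lemma residue_pointI:
  assumes c: "reduced_zero c1 c2"
    and kernel: "\<And>a b c. a \<in> A \<Longrightarrow> b \<in> A \<Longrightarrow> c \<in> A \<Longrightarrow> res a + res b * c1 + res c * c2 = 0 \<Longrightarrow>
      \<exists>p\<in>R. \<exists>q\<in>R. \<exists>r\<in>R. a + b * e1 + c * e2 = t * p + g * q + h * r"
    and "\<pi> \<in> R" "phi c1 c2 \<pi> = 0" "e > 0"
    and "\<exists>p q. p \<in> R \<and> q \<in> R \<and> phi c1 c2 p \<noteq> 0 \<and> phi c1 c2 q \<noteq> 0 \<and> t * q = \<pi> ^ e * p"
    and "\<exists>p q. p \<in> R \<and> q \<in> R \<and> phi c1 c2 q \<noteq> 0 \<and> g * q = \<pi> * p"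
    and "\<exists>p q. p \<in> R \<and> q \<in> R \<and> phi c1 c2 q \<noteq> 0 \<and> h * q = \<pi> * p"
  shows "residue_point F R (phi c1 c2) t \<pi> g h e"
proof
  show "phi c1 c2 1 = 1" using A_closed by (simp add: phi_A res_one)
  have "phi c1 c2 ` R \<subseteq> (\<lambda>(x, y, z). x + y * c1 + z * c2) ` (res ` A \<times> res ` A \<times> res ` A)"
  proof
    fix w assume "w \<in> phi c1 c2 ` R"
    then obtain a b c where *: "a \<in> A" "b \<in> A" "c \<in> A" "w = phi c1 c2 (a + b * e1 + c * e2)"
      unfolding R_def by (auto elim!: span3E)
    thus "w \<in> (\<lambda>(x, y, z). x + y * c1 + z * c2) ` (res ` A \<times> res ` A \<times> res ` A)"
      by (intro image_eqI[of _ _ "(res a, res b, res c)"]) (auto simp: phi_eq)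
  qed
  thus "finite (phi c1 c2 ` R)" by (rule finite_subset) (use finite_res in simp)
  show "t \<in> R" "t \<noteq> 0" using A_R base.pi_mem base.pi_nz by auto
  show "\<exists>k. t ^ k * z \<in> R" if "z \<in> F" for z
  proof -
    obtain u v w where uvw: "u \<in> E" "v \<in> E" "w \<in> E" "z = u + v * \<theta> + w * \<theta> ^ 2"
      using \<open>z \<in> F\<close> unfolding F(2) by (rule span3E)
    have "\<tau> \<in> E" using coeffs base.VF by blast
    hence "v / \<tau> \<in> E" "w / \<tau> \<in> E" using uvw is_subfield_closed(3)[OF base.F] by auto
    then obtain k l m where
      "\<forall>n\<ge>k. t ^ n * u \<in> A" "\<forall>n\<ge>l. t ^ n * (v / \<tau>) \<in> A" "\<forall>n\<ge>m. t ^ n * (w / \<tau>) \<in> A"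
      using clear_denominator uvw by metis
    hence "t ^ (k + l + m) * u \<in> A" "t ^ (k + l + m) * (v / \<tau>) \<in> A" "t ^ (k + l + m) * (w / \<tau>) \<in> A"
      by simp_all
    hence "t ^ (k + l + m) * z \<in> R"
      unfolding R_def using coeffs(4)
      by (intro span3I[of "t ^ (k + l + m) * u" _ "t ^ (k + l + m) * (v / \<tau>)" "t ^ (k + l + m) * (w / \<tau>)"])
        (auto simp: uvw e1_def e2_def distrib_left)
    thus ?thesis by blast
  qed
  show "\<exists>a\<in>R. \<exists>b\<in>R. \<exists>c\<in>R. x = t * a + g * b + h * c" if x: "x \<in> R" "phi c1 c2 x = 0" for x
  proof -
    obtain a b c where *: "a \<in> A" "b \<in> A" "c \<in> A" "x = a + b * e1 + c * e2"
      using x unfolding R_def by (auto elim!: span3E)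
    thus ?thesis using kernel[OF *(1-3)] x by (simp add: phi_eq)
  qed
qed (use assms F subring_R R_F phi_add phi_mult[OF c] in auto)

text \<open>\<open>W\<close> contains \<open>A\<close> because \<open>A\<close> is the sum of \<open>K\<close> and its maximal ideal, and it
  contains \<open>e1\<close> and \<open>e2\<close> because these are integral over \<open>A\<close>.\<close>

lemma valuation_ring_over:
  assumes W: "valuation_ring K F W" and over: "nonunits A \<subseteq> nonunits W"
  shows "valuation_subring F W" "W \<subset> F" "R \<subseteq> W" "t \<in> nonunits W"
proof -
  show vs: "valuation_subring F W" and WF: "W \<subset> F" using W F by (auto simp: valuation_ring_iff)
  interpret W: valuation_subring F W by (rule vs)
  note cl = is_subring_closed[OF W.V]
  show tW: "t \<in> nonunits W" using base.pi_nonunit over by blast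
  have AW: "A \<subseteq> W"
  proof
    fix a assume "a \<in> A"
    then obtain c where "c \<in> K" "a - c \<in> nonunits A" using const_part by blast
    hence "c \<in> W" "a - c \<in> W" using over W F by (auto simp: valuation_ring_iff nonunits_def)
    hence "(a - c) + c \<in> W" by (rule cl(5)[rotated])
    thus "a \<in> W" by simp
  qed
  hence c: "\<tau> \<in> W" "\<alpha> \<in> W" "\<beta> \<in> W" using coeffs by auto
  have "e1 ^ 3 = (- (\<tau> ^ 2 * \<beta>)) + (\<tau> * \<alpha>) * e1 + 0 * e1 ^ 2"
  proof -
    have "e1 ^ 3 = e1 * (e1 * e1)" by (simp add: power3_eq_cube)
    also have "\<dots> = \<tau> * (\<alpha> * e1 - \<tau> * \<beta>)" by (simp add: table mult.left_commute)
    finally show ?thesis by (simp add: algebra_simps power2_eq_square)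
  qed
  hence e1: "e1 \<in> W" by (rule W.integral_closed[rotated]) (use R_F e1_R c in \<open>auto intro!: cl\<close>)
  have "e2 ^ 3 = 0 + (- (\<beta> * e1)) * e2 + \<alpha> * e2 ^ 2"
  proof -
    have "e2 ^ 3 = e2 * (e2 * e2)" by (simp add: power3_eq_cube)
    also have "\<dots> = e2 * (\<alpha> * e2 - \<beta> * e1)" by (simp only: table)
    finally show ?thesis by (simp add: algebra_simps power2_eq_square)
  qed
  hence e2: "e2 \<in> W" by (rule W.integral_closed[rotated]) (use R_F e2_R c e1 in \<open>auto intro!: cl\<close>)
  show "R \<subseteq> W" unfolding R_def using AW e1 e2 by (auto elim!: span3E simp: cl subset_iff)
qed

end

section \<open>Splitting types of the cubic ring\<close>

text \<open>Subtracting the equations of two roots and dividing by their difference gives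
  \<open>u\<^sup>2 + u v + v\<^sup>2 = a\<close>; subtracting two of these relations gives the vanishing of the sum.\<close>

lemma vieta_cubic:
  fixes x y z a b :: "'a::field"
  assumes roots: "x ^ 3 = a * x - b" "y ^ 3 = a * y - b" "z ^ 3 = a * z - b"
    and distinct: "x \<noteq> y" "x \<noteq> z" "y \<noteq> z"
  shows "x + y + z = 0" "x * y + x * z + y * z = - a" "x * y * z = - b"
proof -
  have quad: "u ^ 2 + u * v + v ^ 2 = a" if "u ^ 3 = a * u - b" "v ^ 3 = a * v - b" "u \<noteq> v" for u v
  proof -
    have "(u - v) * (u ^ 2 + u * v + v ^ 2) = u ^ 3 - v ^ 3"
      by (simp add: algebra_simps power2_eq_square power3_eq_cube)
    also have "\<dots> = (u - v) * a" unfolding that by (simp add: algebra_simps)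
    finally show ?thesis using that by simp
  qed
  \<comment> \<open>the difference of the relations for the pairs \<open>x, y\<close> and \<open>x, z\<close>\<close>
  have "(y - z) * (x + y + z) = (x ^ 2 + x * y + y ^ 2) - (x ^ 2 + x * z + z ^ 2)"
    by (simp add: algebra_simps power2_eq_square)
  also have "\<dots> = 0" using quad assms by simp
  finally show sum: "x + y + z = 0" using distinct by simp
  hence z: "z = - x - y" by (simp add: algebra_simps eq_neg_iff_add_eq_0)
  have a: "a = x ^ 2 + x * y + y ^ 2" using quad assms by simp
  show "x * y + x * z + y * z = - a"
    unfolding z a by (simp add: algebra_simps power2_eq_square)
  have "b = a * x - x ^ 3" using roots(1) by simp
  thus "x * y * z = - b"
    unfolding z a by (simp add: algebra_simps power2_eq_square power3_eq_cube)
qed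

context cubic_order
begin

abbreviation local_ring :: "'m \<Rightarrow> 'm \<Rightarrow> 'l set" where
  "local_ring c1 c2 \<equiv> residue_point.loc R (phi c1 c2)"

lemma residue_point_facts:
  assumes "residue_point F R (phi c1 c2) t \<pi> g h e"
  shows "A \<subseteq> local_ring c1 c2 \<and>
    (\<exists>\<pi> w. dvr F (local_ring c1 c2) \<pi> \<and> unit_in (local_ring c1 c2) w \<and> t = \<pi> ^ e * w)"
proof -
  interpret residue_point F R "phi c1 c2" t \<pi> g h e by fact
  show ?thesis using dvr_loc t_eq R_loc A_R by blast
qed

lemma local_rings_distinct:
  assumes p1: "residue_point F R (phi c1 c2) t \<pi> g h e"
    and p2: "residue_point F R (phi d1 d2) t \<pi>' g' h' e'"
    and x: "x \<in> R" "phi c1 c2 x = 0" "phi d1 d2 x \<noteq> 0"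
  shows "local_ring c1 c2 \<noteq> local_ring d1 d2"
  using residue_point.unit_in_loc_iff[OF p1 x(1)] residue_point.unit_in_loc_iff[OF p2 x(1)] x by metis

lemma res_t: "res t = 0"
  using res_eq_0[OF base.pi_mem] base.pi_nonunit by simp

lemma res_zeroE:
  assumes "a \<in> A" "res a = 0"
  obtains a' where "a' \<in> A" "a = t * a'"
  using assms res_eq_0 base.nonunits_eq by blast

lemma unit_in_A_iff: "a \<in> A \<Longrightarrow> unit_in A a \<longleftrightarrow> res a \<noteq> 0"
  using res_eq_0[of a] by (auto simp: unit_in_def nonunits_def)

lemmas R_intros = R_closed e1_R e2_R A_R[THEN subsetD] A_closed

lemma phi_minus: "x \<in> R \<Longrightarrow> phi c1 c2 (- x) = - phi c1 c2 x"
  using phi_add[of x "- x" c1 c2] R_closed res_zero phi_A[of 0] A_closed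
  by (simp add: eq_neg_iff_add_eq_0 add.commute)

lemma phi_diff: "x \<in> R \<Longrightarrow> y \<in> R \<Longrightarrow> phi c1 c2 (x - y) = phi c1 c2 x - phi c1 c2 y"
  using phi_add[of x "- y"] phi_minus[of y] R_closed by simp

text \<open>The form reduces to \<open>X\<^sup>3\<close>, and \<open>\<beta>\<close> has exactly one factor \<open>t\<close>: the equation of
  \<open>e1 = \<theta>\<close> is an Eisenstein equation, so that \<open>e1\<close> is a uniformizer and \<open>t\<close> is its cube up to a unit.\<close>

lemma totally_ramified_at_zero:
  assumes tau: "\<tau> = 1" and al: "res \<alpha> = 0" and be: "\<beta> = t * u" "u \<in> A" "res u \<noteq> 0"
  shows "splits_as K E F (nonunits A) [(nonunits (local_ring 0 0), 3)]"
proof -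
  obtain \<alpha>' where al': "\<alpha>' \<in> A" "\<alpha> = t * \<alpha>'" using al coeffs by (auto elim: res_zeroE)
  have e2: "e2 = e1 * e1" using table tau by simp
  have e1_cube: "e1 ^ 3 = t * (\<alpha>' * e1 - u)"
  proof -
    have "e1 ^ 3 = e1 * e2" by (simp add: e2 power3_eq_cube)
    thus ?thesis unfolding table using tau al' be by (simp add: algebra_simps)
  qed
  have pt: "residue_point F R (phi 0 0) t e1 e1 e2 3"
  proof (rule residue_pointI)
    show "reduced_zero 0 0" unfolding reduced_zero_def using tau al be base.pi_mem by (simp add: res_mult res_t)
    show "\<exists>p\<in>R. \<exists>q\<in>R. \<exists>r\<in>R. a + b * e1 + c * e2 = t * p + e1 * q + e2 * r"
      if abc: "a \<in> A" "b \<in> A" "c \<in> A" "res a + res b * 0 + res c * 0 = 0" for a b c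
    proof -
      obtain a' where "a' \<in> A" "a = t * a'" using abc by (auto elim: res_zeroE)
      thus ?thesis using abc A_R by (intro bexI[of _ a'] bexI[of _ b] bexI[of _ c]) auto
    qed
    have "phi 0 0 (\<alpha>' * e1 - u) = - res u"
      using phi_eq[of "- u" \<alpha>' 0 0 0] al' be A_closed by (simp add: res_minus)
    moreover have "\<alpha>' * e1 - u \<in> R" using al' be by (auto simp: R_intros)
    ultimately show "\<exists>p q. p \<in> R \<and> q \<in> R \<and> phi 0 0 p \<noteq> 0 \<and> phi 0 0 q \<noteq> 0 \<and> t * q = e1 ^ 3 * p"
      using be by (intro exI[of _ 1] exI[of _ "\<alpha>' * e1 - u"])
        (simp add: e1_cube R_closed phi_A A_closed res_one)
    show "\<exists>p q. p \<in> R \<and> q \<in> R \<and> phi 0 0 q \<noteq> 0 \<and> e1 * q = e1 * p"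
      by (intro exI[of _ 1]) (simp add: R_closed phi_A A_closed res_one)
    show "\<exists>p q. p \<in> R \<and> q \<in> R \<and> phi 0 0 q \<noteq> 0 \<and> e2 * q = e1 * p"
      by (intro exI[of _ e1] exI[of _ 1]) (simp add: R_closed e1_R e2 phi_A A_closed res_one)
  qed (auto simp: e1_R phi_e1)
  have "splits_as K E F (nonunits A) (map (\<lambda>(V, e). (nonunits V, e)) [(local_ring 0 0, 3)])"
  proof (rule splits_asI[OF base K])
    fix W assume W: "valuation_ring K F W" "nonunits A \<subseteq> nonunits W"
    note over = valuation_ring_over[OF W]
    interpret W: valuation_subring F W by (rule over)
    have q: "\<alpha>' * e1 - u \<in> W" using al' be over(3) by (auto simp: R_intros)
    have e1W: "e1 \<in> W" using e1_R over by blast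
    have "e1 * (e1 * e1) \<in> nonunits W"
      using W.nonunits_mult[OF over(4) q] e1_cube by (simp add: power3_eq_cube mult.assoc)
    hence e1: "e1 \<in> nonunits W" using W.nonunits_prime e1W W.V is_subring_closed(6) by metis
    hence "e2 \<in> nonunits W" unfolding e2 using W.nonunits_mult e1W by blast
    thus "W \<in> fst ` set [(local_ring 0 0, 3)]"
      using residue_point.loc_unique[OF pt over(1-4)] e1 by simp
  qed (use residue_point_facts[OF pt] in auto)
  thus ?thesis by simp
qed

text \<open>The form reduces to a multiple of \<open>Y\<^sup>3\<close>, with a triple zero at infinity. The relations
  \<open>e1\<^sup>2 = t e2\<close> and \<open>\<beta> e1 = e2 (\<alpha> - e2)\<close> give \<open>t \<beta>\<^sup>2 = e2 (\<alpha> - e2)\<^sup>2\<close>. As \<open>t\<close>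
  divides \<open>\<alpha>\<close>, expanding the square shows that \<open>t\<close> is \<open>e2\<^sup>3\<close> up to a unit.\<close>

lemma totally_ramified_at_infinity:
  assumes tau: "\<tau> = t" and al: "res \<alpha> = 0" and be: "res \<beta> \<noteq> 0"
  shows "splits_as K E F (nonunits A) [(nonunits (local_ring 0 0), 3)]"
proof -
  obtain \<alpha>' where al': "\<alpha>' \<in> A" "\<alpha> = t * \<alpha>'" using al coeffs by (auto elim: res_zeroE)
  have be_e1: "e1 * \<beta> = e2 * (\<alpha> - e2)" using table(3) by (simp add: algebra_simps)
  have "\<theta> \<noteq> 0" using cubic be res_zero by auto
  hence e2_nz: "e2 \<noteq> 0" using coeffs by (simp add: e2_def)
  \<comment> \<open>the unit \<open>e2 ^ 3 / t\<close>, obtained by expanding the square in \<open>*\<close> below with \<open>\<alpha> = t * \<alpha>'\<close>\<close>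
  define q where "q = \<beta> ^ 2 - t * \<alpha>' ^ 2 * e2 + (\<alpha>' * e2 ^ 2 + \<alpha>' * e2 ^ 2)"
  have q: "t * q = e2 ^ 3"
  proof -
    have "e2 * (t * \<beta> ^ 2) = (e1 * \<beta>) ^ 2" using table(1) tau by (simp add: power2_eq_square algebra_simps)
    also have "\<dots> = e2 * (e2 * (\<alpha> - e2) ^ 2)" unfolding be_e1 by (simp add: power2_eq_square algebra_simps)
    finally have *: "t * \<beta> ^ 2 = e2 * (\<alpha> - e2) ^ 2" using e2_nz by simp
    have "t * q = t * \<beta> ^ 2 - e2 * (\<alpha> ^ 2 - 2 * \<alpha> * e2)"
      by (simp add: q_def al' power2_eq_square algebra_simps)
    thus ?thesis unfolding * by (simp add: power2_eq_square power3_eq_cube algebra_simps)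
  qed
  have red: "reduced_zero 0 0" unfolding reduced_zero_def using tau by (simp add: res_t)
  have qR: "q \<in> R" unfolding q_def
    by (intro R_closed(3,5,6,7)) (use al' in \<open>simp_all add: R_intros\<close>)
  have phi_q: "phi 0 0 q = res \<beta> ^ 2"
  proof -
    have "q = \<beta> * \<beta> + e2 * (\<alpha>' * e2 + \<alpha>' * e2 - t * \<alpha>' ^ 2)"
      by (simp add: q_def algebra_simps power2_eq_square)
    moreover have "\<alpha>' * e2 + \<alpha>' * e2 - t * \<alpha>' ^ 2 \<in> R"
      by (intro R_closed(3,5,6,7)) (use al' in \<open>simp_all add: R_intros\<close>)
    ultimately show ?thesis
      by (simp add: phi_add phi_mult[OF red] phi_e2 phi_A R_intros res_mult power2_eq_square)
  qed
  have pt: "residue_point F R (phi 0 0) t e2 e1 e2 3"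
  proof (rule residue_pointI[OF red])
    show "\<exists>p\<in>R. \<exists>q\<in>R. \<exists>r\<in>R. a + b * e1 + c * e2 = t * p + e1 * q + e2 * r"
      if abc: "a \<in> A" "b \<in> A" "c \<in> A" "res a + res b * 0 + res c * 0 = 0" for a b c
    proof -
      obtain a' where "a' \<in> A" "a = t * a'" using abc by (auto elim: res_zeroE)
      thus ?thesis using abc A_R by (intro bexI[of _ a'] bexI[of _ b] bexI[of _ c]) auto
    qed
    show "\<exists>p q. p \<in> R \<and> q \<in> R \<and> phi 0 0 p \<noteq> 0 \<and> phi 0 0 q \<noteq> 0 \<and> t * q = e2 ^ 3 * p"
      using be by (intro exI[of _ 1] exI[of _ q]) (simp add: q qR phi_q R_closed phi_A A_closed res_one)
    show "\<exists>p q. p \<in> R \<and> q \<in> R \<and> phi 0 0 q \<noteq> 0 \<and> e1 * q = e2 * p"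
      using be by (intro exI[of _ "\<alpha> - e2"] exI[of _ \<beta>]) (auto simp: be_e1 phi_A A_closed R_intros)
    show "\<exists>p q. p \<in> R \<and> q \<in> R \<and> phi 0 0 q \<noteq> 0 \<and> e2 * q = e2 * p"
      by (intro exI[of _ 1]) (simp add: R_closed phi_A A_closed res_one)
  qed (auto simp: e2_R phi_e2)
  have "splits_as K E F (nonunits A) (map (\<lambda>(V, e). (nonunits V, e)) [(local_ring 0 0, 3)])"
  proof (rule splits_asI[OF base K])
    fix W assume W: "valuation_ring K F W" "nonunits A \<subseteq> nonunits W"
    note over = valuation_ring_over[OF W]
    interpret W: valuation_subring F W by (rule over)
    have eW: "e1 \<in> W" "e2 \<in> W" using e1_R e2_R over by auto
    have "e1 * e1 \<in> nonunits W" using W.nonunits_mult[OF over(4) eW(2)] table(1) tau by simp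
    hence e1: "e1 \<in> nonunits W" using W.nonunits_prime eW by blast
    have "t * (\<alpha>' * e2) + e1 * (- \<beta>) \<in> nonunits W"
      using over al' coeffs by (intro W.nonunits_add W.nonunits_mult[OF over(4)] W.nonunits_mult[OF e1])
        (auto intro!: subsetD[OF over(3)] simp: R_intros)
    moreover have "e2 * e2 = t * (\<alpha>' * e2) + e1 * (- \<beta>)"
      unfolding table(3) al'(2) by (simp add: algebra_simps)
    ultimately have "e2 * e2 \<in> nonunits W" by simp
    hence "e2 \<in> nonunits W" using W.nonunits_prime eW by blast
    thus "W \<in> fst ` set [(local_ring 0 0, 3)]"
      using residue_point.loc_unique[OF pt over(1-4)] e1 by simp
  qed (use residue_point_facts[OF pt] in auto)
  thus ?thesis by simp
qed

text \<open>The form reduces to \<open>Y\<^sup>2 (\<beta> Y - \<alpha> X)\<close>, with a simple zero where \<open>e2\<close> vanishes and a double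
  zero at infinity, where \<open>e2\<close> takes the value of \<open>\<alpha>\<close>. At the simple zero \<open>e2 - \<alpha>\<close> is
  invertible, and \<open>e1 (e2 - \<alpha>) = - t \<beta>\<close> and \<open>e2 (e2 - \<alpha>) = - \<beta> e1\<close> make \<open>t\<close> a
  uniformizer. At infinity \<open>e2\<close> is invertible, and \<open>t = e1\<^sup>2 / e2\<close>.\<close>

lemma partially_ramified:
  assumes tau: "\<tau> = t" and al: "res \<alpha> \<noteq> 0"
  shows "splits_as K E F (nonunits A)
    [(nonunits (local_ring 0 0), 1), (nonunits (local_ring 0 (res \<alpha>)), 2)]"
proof -
  have e1_rel: "e1 * (e2 - \<alpha>) = t * (- \<beta>)" using table(2) tau by (simp add: algebra_simps)
  have e2_rel: "e2 * (e2 - \<alpha>) = e1 * (- \<beta>)" using table(3) by (simp add: algebra_simps)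
  have red: "reduced_zero 0 0" "reduced_zero 0 (res \<alpha>)"
    unfolding reduced_zero_def using tau by (simp_all add: res_t)
  have dR: "e2 - \<alpha> \<in> R" by (auto simp: R_intros)
  have phi_d: "phi c1 c2 (e2 - \<alpha>) = c2 - res \<alpha>" for c1 c2
    using phi_eq[of "- \<alpha>" 0 1 c1 c2] A_closed by (simp add: res_minus res_zero res_one)
  have te2: "t * e2 = e1 * e1" using table(1) unfolding tau by (rule sym)
  have pt1: "residue_point F R (phi 0 0) t t e1 e2 1"
  proof (rule residue_pointI[OF red(1)])
    show "\<exists>p\<in>R. \<exists>q\<in>R. \<exists>r\<in>R. a + b * e1 + c * e2 = t * p + e1 * q + e2 * r"
      if abc: "a \<in> A" "b \<in> A" "c \<in> A" "res a + res b * 0 + res c * 0 = 0" for a b c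
    proof -
      obtain a' where "a' \<in> A" "a = t * a'" using abc by (auto elim: res_zeroE)
      thus ?thesis using abc A_R by (intro bexI[of _ a'] bexI[of _ b] bexI[of _ c]) auto
    qed
    show "\<exists>p q. p \<in> R \<and> q \<in> R \<and> phi 0 0 p \<noteq> 0 \<and> phi 0 0 q \<noteq> 0 \<and> t * q = t ^ 1 * p"
      by (intro exI[of _ 1]) (simp add: R_closed phi_A A_closed res_one)
    show "\<exists>p q. p \<in> R \<and> q \<in> R \<and> phi 0 0 q \<noteq> 0 \<and> e1 * q = t * p"
      using al by (intro exI[of _ "- \<beta>"] exI[of _ "e2 - \<alpha>"]) (auto simp: e1_rel dR phi_d R_intros)
    have "e2 * ((e2 - \<alpha>) * (e2 - \<alpha>)) = (e1 * (- \<beta>)) * (e2 - \<alpha>)"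
      unfolding e2_rel[symmetric] by (simp only: mult.assoc)
    also have "\<dots> = (e1 * (e2 - \<alpha>)) * (- \<beta>)" by (simp only: mult_ac)
    also have "\<dots> = t * (\<beta> * \<beta>)" unfolding e1_rel by simp
    finally show "\<exists>p q. p \<in> R \<and> q \<in> R \<and> phi 0 0 q \<noteq> 0 \<and> e2 * q = t * p"
      using al by (intro exI[of _ "\<beta> * \<beta>"] exI[of _ "(e2 - \<alpha>) * (e2 - \<alpha>)"])
        (auto simp: dR phi_d phi_mult[OF red(1)] R_closed R_intros)
  qed (use A_R base.pi_mem in \<open>auto simp: phi_A res_t\<close>)
  have pt2: "residue_point F R (phi 0 (res \<alpha>)) t e1 e1 (e2 - \<alpha>) 2"
  proof (rule residue_pointI[OF red(2)])
    show "\<exists>p\<in>R. \<exists>q\<in>R. \<exists>r\<in>R. a + b * e1 + c * e2 = t * p + e1 * q + (e2 - \<alpha>) * r"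
      if abc: "a \<in> A" "b \<in> A" "c \<in> A" "res a + res b * 0 + res c * res \<alpha> = 0" for a b c
    proof -
      have "res (a + c * \<alpha>) = 0" "a + c * \<alpha> \<in> A" using abc by (simp_all add: res_add res_mult A_closed)
      then obtain a' where a': "a' \<in> A" "a + c * \<alpha> = t * a'" by (auto elim: res_zeroE)
      have "a + b * e1 + c * e2 = (a + c * \<alpha>) + e1 * b + (e2 - \<alpha>) * c" by (simp add: algebra_simps)
      thus ?thesis unfolding a'(2) using abc a' A_R by blast
    qed
    show "\<exists>p q. p \<in> R \<and> q \<in> R \<and> phi 0 (res \<alpha>) p \<noteq> 0 \<and> phi 0 (res \<alpha>) q \<noteq> 0 \<and> t * q = e1 ^ 2 * p"
      using al by (intro exI[of _ 1] exI[of _ e2])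
        (simp add: te2 R_closed e2_R phi_e2 phi_A A_closed res_one power2_eq_square)
    show "\<exists>p q. p \<in> R \<and> q \<in> R \<and> phi 0 (res \<alpha>) q \<noteq> 0 \<and> e1 * q = e1 * p"
      by (intro exI[of _ 1]) (simp add: R_closed phi_A A_closed res_one)
    show "\<exists>p q. p \<in> R \<and> q \<in> R \<and> phi 0 (res \<alpha>) q \<noteq> 0 \<and> (e2 - \<alpha>) * q = e1 * p"
      using al e2_rel by (intro exI[of _ "- \<beta>"] exI[of _ e2])
        (auto simp: phi_e2 mult.commute R_intros)
  qed (auto simp: e1_R phi_e1)
  have "splits_as K E F (nonunits A) (map (\<lambda>(V, e). (nonunits V, e))
      [(local_ring 0 0, 1), (local_ring 0 (res \<alpha>), 2)])"
  proof (rule splits_asI[OF base K])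
    show "distinct (map fst [(local_ring 0 0, 1 :: nat), (local_ring 0 (res \<alpha>), 2)])"
      using local_rings_distinct[OF pt1 pt2 e2_R] al by (simp add: phi_e2)
    fix W assume W: "valuation_ring K F W" "nonunits A \<subseteq> nonunits W"
    note over = valuation_ring_over[OF W]
    interpret W: valuation_subring F W by (rule over)
    have eW: "e1 \<in> W" "e2 \<in> W" "- \<beta> \<in> W" "e2 - \<alpha> \<in> W" using over(3) dR by (auto simp: R_intros)
    have "e1 * e1 \<in> nonunits W" using W.nonunits_mult[OF over(4) eW(2)] table(1) tau by simp
    hence e1: "e1 \<in> nonunits W" using W.nonunits_prime eW by blast
    have "e2 * (e2 - \<alpha>) \<in> nonunits W" unfolding e2_rel using W.nonunits_mult e1 eW by blast
    hence "e2 \<in> nonunits W \<or> e2 - \<alpha> \<in> nonunits W" using W.nonunits_prime eW by blast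
    thus "W \<in> fst ` set [(local_ring 0 0, 1), (local_ring 0 (res \<alpha>), 2)]"
      using residue_point.loc_unique[OF pt1 over(1-4)] residue_point.loc_unique[OF pt2 over(1-4)] e1 by auto
  next
    fix V and e :: nat assume "(V, e) \<in> set [(local_ring 0 0, 1), (local_ring 0 (res \<alpha>), 2)]"
    hence "V = local_ring 0 0 \<and> e = 1 \<or> V = local_ring 0 (res \<alpha>) \<and> e = 2" by auto
    thus "A \<subseteq> V \<and> (\<exists>\<pi> w. dvr F V \<pi> \<and> unit_in V w \<and> t = \<pi> ^ e * w)"
      using residue_point_facts[OF pt1] residue_point_facts[OF pt2] by blast
  qed auto
  thus ?thesis by simp
qed

lemma subfield_res: "is_subfield (res ` A)"
  unfolding is_subfield_def is_subring_def
proof (intro conjI ballI)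
  show "1 \<in> res ` A" using A_closed res_one by force
  fix x y assume "x \<in> res ` A" "y \<in> res ` A"
  then obtain a b where "a \<in> A" "x = res a" "b \<in> A" "y = res b" by blast
  thus "x - y \<in> res ` A" "x * y \<in> res ` A"
    using A_closed by (simp_all flip: res_diff res_mult)
next
  fix x assume "x \<in> res ` A"
  then obtain a where a: "a \<in> A" "x = res a" by blast
  show "inverse x \<in> res ` A"
  proof (cases "x = 0")
    case True
    thus ?thesis using res_zero A_closed by force
  next
    case False
    hence u: "unit_in A a" using a unit_in_A_iff by simp
    have "x * res (inverse a) = res (a * inverse a)"
      unfolding a(2) by (rule res_mult[symmetric]) (use a u in \<open>auto simp: unit_in_def\<close>)
    hence "x * res (inverse a) = 1" using u res_one by (simp add: unit_in_def)
    hence "inverse x = res (inverse a)" by (rule inverse_unique)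
    thus ?thesis using u by (auto simp: unit_in_def)
  qed
qed

lemma reduced_zero_of_root:
  assumes "\<tau> = 1" "\<gamma> ^ 3 = res \<alpha> * \<gamma> - res \<beta>"
  shows "reduced_zero \<gamma> (\<gamma> ^ 2)"
proof -
  have "\<gamma> * \<gamma> ^ 2 = \<gamma> ^ 3" by (simp add: power2_eq_square power3_eq_cube)
  moreover have "\<gamma> ^ 2 * \<gamma> ^ 2 = \<gamma> * \<gamma> ^ 3" by (simp add: power2_eq_square power3_eq_cube)
  ultimately show ?thesis
    unfolding reduced_zero_def using assms res_one by (simp add: algebra_simps power2_eq_square)
qed

text \<open>The quotient of \<open>T\<^sup>3 - \<alpha> T + \<beta>\<close> by \<open>T - c\<close>, evaluated at \<open>T = e1\<close> when
  \<open>\<tau> = 1\<close>.\<close>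

definition cofactor :: "'l \<Rightarrow> 'l" where
  "cofactor c = e2 + c * e1 + (c ^ 2 - \<alpha>)"

lemma cofactor_R: "c \<in> A \<Longrightarrow> cofactor c \<in> R"
  unfolding cofactor_def by (auto simp: R_intros)

lemma phi_cofactor: "c \<in> A \<Longrightarrow> phi c1 c2 (cofactor c) = c2 + res c * c1 + (res c ^ 2 - res \<alpha>)"
  using phi_eq[of "c ^ 2 - \<alpha>" c 1 c1 c2] A_closed
  by (simp add: cofactor_def res_diff res_mult res_one power2_eq_square algebra_simps)

lemma phi_linear: "c \<in> A \<Longrightarrow> phi c1 c2 (e1 - c) = c1 - res c"
  using phi_diff[OF e1_R, of c] A_R by (auto simp: phi_e1 phi_A)

lemma linear_times_cofactor:
  assumes tau: "\<tau> = 1" and c: "c \<in> A" "res c ^ 3 = res \<alpha> * res c - res \<beta>"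
  obtains m where "m \<in> A" "(e1 - c) * cofactor c = t * m"
proof -
  have "e1 * e1 = e2" "e1 * e2 = \<alpha> * e1 - \<beta>" using table tau by simp_all
  hence "(e1 - c) * cofactor c = - (c ^ 3 - \<alpha> * c + \<beta>)"
    by (simp add: cofactor_def algebra_simps power2_eq_square power3_eq_cube)
  moreover have "res (- (c ^ 3 - \<alpha> * c + \<beta>)) = 0"
    using c by (simp add: res_minus res_add res_diff res_mult power3_eq_cube A_closed algebra_simps)
  moreover have "- (c ^ 3 - \<alpha> * c + \<beta>) \<in> A" using c by (simp add: A_closed)
  ultimately show ?thesis using res_zeroE that by metis
qed

text \<open>At a finite zero with local uniformizer \<open>t\<close>, one further generator \<open>g\<close> of the kernel is enough, and
  \<open>h\<close> is filled up with \<open>0\<close>.\<close>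

lemma unramified_residue_pointI:
  assumes tau: "\<tau> = 1" and \<gamma>: "\<gamma> ^ 3 = res \<alpha> * \<gamma> - res \<beta>"
    and kernel: "\<And>a b c. a \<in> A \<Longrightarrow> b \<in> A \<Longrightarrow> c \<in> A \<Longrightarrow> res a + res b * \<gamma> + res c * \<gamma> ^ 2 = 0 \<Longrightarrow>
      \<exists>p\<in>R. \<exists>q\<in>R. a + b * e1 + c * e2 = t * p + g * q"
    and g: "\<exists>p q. p \<in> R \<and> q \<in> R \<and> phi \<gamma> (\<gamma> ^ 2) q \<noteq> 0 \<and> g * q = t * p"
  shows "residue_point F R (phi \<gamma> (\<gamma> ^ 2)) t t g 0 1"
proof (rule residue_pointI[OF reduced_zero_of_root[OF tau \<gamma>]])
  show "\<exists>p\<in>R. \<exists>q\<in>R. \<exists>r\<in>R. a + b * e1 + c * e2 = t * p + g * q + 0 * r"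
    if "a \<in> A" "b \<in> A" "c \<in> A" "res a + res b * \<gamma> + res c * \<gamma> ^ 2 = 0" for a b c
    using kernel[OF that] R_closed by auto
  show "\<exists>p q. p \<in> R \<and> q \<in> R \<and> phi \<gamma> (\<gamma> ^ 2) p \<noteq> 0 \<and> phi \<gamma> (\<gamma> ^ 2) q \<noteq> 0 \<and> t * q = t ^ 1 * p"
    by (intro exI[of _ 1]) (simp add: R_closed phi_A A_closed res_one)
  show "\<exists>p q. p \<in> R \<and> q \<in> R \<and> phi \<gamma> (\<gamma> ^ 2) q \<noteq> 0 \<and> 0 * q = t * p"
    by (intro exI[of _ 0] exI[of _ 1]) (simp add: R_closed phi_A A_closed res_one)
qed (use g A_R base.pi_mem in \<open>auto simp: phi_A res_t\<close>)

text \<open>The kernel is generated by \<open>t\<close> and \<open>e1 - c\<close>. The cofactor of \<open>e1 - c\<close> takes at this point the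
  value of the derivative of the reduced cubic, which is nonzero, so \<open>e1 - c\<close> is a multiple of
  \<open>t\<close> locally.\<close>

lemma rational_residue_point:
  assumes tau: "\<tau> = 1" and c: "c \<in> A" "res c ^ 3 = res \<alpha> * res c - res \<beta>"
    and simple: "3 * res c ^ 2 \<noteq> res \<alpha>"
  shows "residue_point F R (phi (res c) (res c ^ 2)) t t (e1 - c) 0 1"
proof (rule unramified_residue_pointI[OF tau c(2)])
  show "\<exists>p\<in>R. \<exists>q\<in>R. a + b * e1 + d * e2 = t * p + (e1 - c) * q"
    if abd: "a \<in> A" "b \<in> A" "d \<in> A" "res a + res b * res c + res d * res c ^ 2 = 0" for a b d
  proof -
    have "res (a + b * c + d * c ^ 2) = 0" "a + b * c + d * c ^ 2 \<in> A"
      using abd c by (simp_all add: res_add res_mult A_closed power2_eq_square)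
    then obtain m where m: "m \<in> A" "a + b * c + d * c ^ 2 = t * m" by (auto elim: res_zeroE)
    have "a + b * e1 + d * e2 = (a + b * c + d * c ^ 2) + (e1 - c) * (b + d * (e1 + c))"
      using table(1) tau by (simp add: algebra_simps power2_eq_square)
    moreover have "b + d * (e1 + c) \<in> R" using abd c by (auto simp: R_intros)
    ultimately show ?thesis unfolding m(2) using m(1) A_R by blast
  qed
  obtain m where "m \<in> A" "(e1 - c) * cofactor c = t * m" by (rule linear_times_cofactor[OF tau c])
  moreover have "phi (res c) (res c ^ 2) (cofactor c) = 3 * res c ^ 2 - res \<alpha>"
    using c by (simp add: phi_cofactor power2_eq_square algebra_simps)
  ultimately show "\<exists>p q. p \<in> R \<and> q \<in> R \<and> phi (res c) (res c ^ 2) q \<noteq> 0 \<and> (e1 - c) * q = t * p"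
    using simple c A_R cofactor_R by (intro exI[of _ m] exI[of _ "cofactor c"]) auto
qed

text \<open>Here the reduced cubic is a linear factor times a quadratic without rational roots. As
  \<open>\<gamma>\<close> has degree 2, a combination of \<open>1\<close> and \<open>e1\<close> in the kernel has both coefficients divisible by
  \<open>t\<close>, so the kernel is generated by \<open>t\<close> and the quadratic factor. The linear factor is invertible at
  this point.\<close>

lemma quadratic_residue_point:
  assumes tau: "\<tau> = 1" and c: "c \<in> A" "res c ^ 3 = res \<alpha> * res c - res \<beta>"
    and \<gamma>: "\<gamma> ^ 2 + res c * \<gamma> + (res c ^ 2 - res \<alpha>) = 0" "\<gamma> \<notin> res ` A"
  shows "residue_point F R (phi \<gamma> (\<gamma> ^ 2)) t t (cofactor c) 0 1"
proof (rule unramified_residue_pointI[OF tau])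
  have "(\<gamma> - res c) * (\<gamma> ^ 2 + res c * \<gamma> + (res c ^ 2 - res \<alpha>)) = \<gamma> ^ 3 - res \<alpha> * \<gamma> - (res c ^ 3 - res \<alpha> * res c)"
    by (simp add: algebra_simps power2_eq_square power3_eq_cube)
  thus "\<gamma> ^ 3 = res \<alpha> * \<gamma> - res \<beta>" unfolding \<gamma>(1) c(2) by (simp add: algebra_simps)
  have \<gamma>2: "\<gamma> ^ 2 = - res c * \<gamma> - (res c ^ 2 - res \<alpha>)"
    using \<gamma>(1) by (simp add: algebra_simps eq_neg_iff_add_eq_0)
  show "\<exists>p\<in>R. \<exists>q\<in>R. a + b * e1 + d * e2 = t * p + cofactor c * q"
    if abd: "a \<in> A" "b \<in> A" "d \<in> A" "res a + res b * \<gamma> + res d * \<gamma> ^ 2 = 0" for a b d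
  proof -
    \<comment> \<open>remainder after subtracting \<open>d\<close> times the quadratic factor\<close>
    define u v where "u = a - d * (c ^ 2 - \<alpha>)" and "v = b - d * c"
    have uv: "u \<in> A" "v \<in> A" using abd c by (auto simp: u_def v_def A_closed)
    have res_uv: "res u = res a - res d * (res c ^ 2 - res \<alpha>)" "res v = res b - res d * res c"
      using abd c by (simp_all add: u_def v_def res_diff res_mult A_closed power2_eq_square)
    have "res u + res v * \<gamma> = res a + res b * \<gamma> + res d * (- res c * \<gamma> - (res c ^ 2 - res \<alpha>))"
      unfolding res_uv by (simp add: algebra_simps)
    also have "\<dots> = 0" using abd(4) by (simp only: \<gamma>2)
    finally have rel: "res u + res v * \<gamma> = 0" .
    have v0: "res v = 0"
    proof (rule ccontr)
      assume "res v \<noteq> 0"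
      hence "\<gamma> = res (- u) / res v" using rel uv by (simp add: res_minus field_simps eq_neg_iff_add_eq_0)
      thus False using \<gamma>(2) uv is_subfield_closed(3)[OF subfield_res, of "res (- u)" "res v"] A_closed by auto
    qed
    hence "res u = 0" using rel by simp
    then obtain u' v' where uv': "u' \<in> A" "u = t * u'" "v' \<in> A" "v = t * v'"
      using uv v0 by (metis res_zeroE)
    have "a + b * e1 + d * e2 = u + v * e1 + cofactor c * d"
      by (simp add: u_def v_def cofactor_def algebra_simps)
    hence "a + b * e1 + d * e2 = t * (u' + v' * e1) + cofactor c * d"
      unfolding uv' by (simp add: algebra_simps)
    moreover have "u' + v' * e1 \<in> R" using uv' by (auto simp: R_intros)
    ultimately show ?thesis using abd(3) A_R by blast
  qed
  obtain m where "m \<in> A" "(e1 - c) * cofactor c = t * m" by (rule linear_times_cofactor[OF tau c])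
  moreover have "e1 - c \<in> R" using c by (auto simp: R_intros)
  ultimately show "\<exists>p q. p \<in> R \<and> q \<in> R \<and> phi \<gamma> (\<gamma> ^ 2) q \<noteq> 0 \<and> cofactor c * q = t * p"
    using \<gamma>(2) c A_R by (intro exI[of _ m] exI[of _ "e1 - c"]) (auto simp: phi_linear mult.commute)
qed

lemma zero_nonunit: "is_subring W \<Longrightarrow> 0 \<in> nonunits W"
  by (simp add: nonunits_def is_subring_closed)

text \<open>A root of the reduced cubic has degree 3 over the residue field, so the kernel is generated by
  \<open>t\<close> alone.\<close>

lemma inert:
  assumes tau: "\<tau> = 1" and \<gamma>: "\<gamma> ^ 3 = res \<alpha> * \<gamma> - res \<beta>"
    and no_root: "\<And>c. c \<in> A \<Longrightarrow> res c ^ 3 \<noteq> res \<alpha> * res c - res \<beta>"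
  shows "splits_as K E F (nonunits A) [(nonunits (local_ring \<gamma> (\<gamma> ^ 2)), 1)]"
proof -
  interpret red: cubic_over "res ` A" "res \<alpha>" "res \<beta>" \<gamma>
    using subfield_res coeffs \<gamma> no_root by unfold_locales auto
  have pt: "residue_point F R (phi \<gamma> (\<gamma> ^ 2)) t t 0 0 1"
  proof (rule unramified_residue_pointI[OF tau \<gamma>])
    show "\<exists>p\<in>R. \<exists>q\<in>R. a + b * e1 + c * e2 = t * p + 0 * q"
      if abc: "a \<in> A" "b \<in> A" "c \<in> A" "res a + res b * \<gamma> + res c * \<gamma> ^ 2 = 0" for a b c
    proof -
      have "res a = 0 \<and> res b = 0 \<and> res c = 0" using red.indep abc by blast
      then obtain a' b' c' where *: "a' \<in> A" "a = t * a'" "b' \<in> A" "b = t * b'" "c' \<in> A" "c = t * c'"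
        using abc by (metis res_zeroE)
      hence "a + b * e1 + c * e2 = t * (a' + b' * e1 + c' * e2) + 0 * 0" by (simp add: algebra_simps)
      moreover have "a' + b' * e1 + c' * e2 \<in> R" using * by (auto simp: R_intros)
      ultimately show ?thesis using R_closed by blast
    qed
    show "\<exists>p q. p \<in> R \<and> q \<in> R \<and> phi \<gamma> (\<gamma> ^ 2) q \<noteq> 0 \<and> 0 * q = t * p"
      by (intro exI[of _ 0] exI[of _ 1]) (simp add: R_closed phi_A A_closed res_one)
  qed
  have "splits_as K E F (nonunits A) (map (\<lambda>(V, e). (nonunits V, e)) [(local_ring \<gamma> (\<gamma> ^ 2), 1)])"
  proof (rule splits_asI[OF base K])
    fix W assume W: "valuation_ring K F W" "nonunits A \<subseteq> nonunits W"
    note over = valuation_ring_over[OF W]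
    show "W \<in> fst ` set [(local_ring \<gamma> (\<gamma> ^ 2), 1)]"
      using residue_point.loc_unique[OF pt over(1-4)] zero_nonunit[OF valuation_subring.V[OF over(1)]] by simp
  qed (use residue_point_facts[OF pt] in auto)
  thus ?thesis by simp
qed

lemma one_rational_root:
  assumes tau: "\<tau> = 1" and c: "c \<in> A" "res c ^ 3 = res \<alpha> * res c - res \<beta>"
    and simple: "3 * res c ^ 2 \<noteq> res \<alpha>"
    and \<gamma>: "\<gamma> ^ 2 + res c * \<gamma> + (res c ^ 2 - res \<alpha>) = 0" "\<gamma> \<notin> res ` A"
  shows "splits_as K E F (nonunits A)
    [(nonunits (local_ring (res c) (res c ^ 2)), 1), (nonunits (local_ring \<gamma> (\<gamma> ^ 2)), 1)]"
proof -
  note pt1 = rational_residue_point[OF tau c simple]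
  note pt2 = quadratic_residue_point[OF tau c \<gamma>]
  let ?vs = "[(local_ring (res c) (res c ^ 2), 1), (local_ring \<gamma> (\<gamma> ^ 2), 1 :: nat)]"
  have lR: "e1 - c \<in> R" using c by (auto simp: R_intros)
  have "splits_as K E F (nonunits A) (map (\<lambda>(V, e). (nonunits V, e)) ?vs)"
  proof (rule splits_asI[OF base K])
    show "distinct (map fst ?vs)"
      using local_rings_distinct[OF pt1 pt2 lR] \<gamma>(2) c by (auto simp: phi_linear)
    fix W assume W: "valuation_ring K F W" "nonunits A \<subseteq> nonunits W"
    note over = valuation_ring_over[OF W]
    interpret W: valuation_subring F W by (rule over)
    obtain m where m: "m \<in> A" "(e1 - c) * cofactor c = t * m" by (rule linear_times_cofactor[OF tau c])
    have "(e1 - c) * cofactor c \<in> nonunits W"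
      unfolding m(2) using m(1) A_R over by (intro W.nonunits_mult) auto
    hence "e1 - c \<in> nonunits W \<or> cofactor c \<in> nonunits W"
      using W.nonunits_prime lR cofactor_R[OF c(1)] over(3) by blast
    thus "W \<in> fst ` set ?vs"
      using residue_point.loc_unique[OF pt1 over(1-4)] residue_point.loc_unique[OF pt2 over(1-4)]
        zero_nonunit[OF W.V] by auto
  next
    fix V e assume "(V, e) \<in> set ?vs"
    hence "(V = local_ring (res c) (res c ^ 2) \<or> V = local_ring \<gamma> (\<gamma> ^ 2)) \<and> e = 1" by auto
    thus "A \<subseteq> V \<and> (\<exists>\<pi> w. dvr F V \<pi> \<and> unit_in V w \<and> t = \<pi> ^ e * w)"
      using residue_point_facts[OF pt1] residue_point_facts[OF pt2] by blast
  qed auto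
  thus ?thesis by simp
qed

text \<open>By the relations between roots and coefficients, the product of the three elements \<open>e1 - c\<close> is
  divisible by \<open>t\<close>. Hence the maximal ideal of any valuation ring above contains one of them.\<close>

lemma three_rational_roots:
  assumes tau: "\<tau> = 1"
    and roots: "\<And>c. c \<in> {c1, c2, c3} \<Longrightarrow> c \<in> A \<and> res c ^ 3 = res \<alpha> * res c - res \<beta> \<and> 3 * res c ^ 2 \<noteq> res \<alpha>"
    and distinct: "res c1 \<noteq> res c2" "res c1 \<noteq> res c3" "res c2 \<noteq> res c3"
  shows "splits_as K E F (nonunits A)
    (map (\<lambda>c. (nonunits (local_ring (res c) (res c ^ 2)), 1)) [c1, c2, c3])"
proof -
  have A: "c1 \<in> A" "c2 \<in> A" "c3 \<in> A" using roots by auto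
  have pt: "residue_point F R (phi (res c) (res c ^ 2)) t t (e1 - c) 0 1" if "c \<in> {c1, c2, c3}" for c
    using rational_residue_point[OF tau, of c] roots[OF that] by simp
  have dist: "local_ring (res c) (res c ^ 2) \<noteq> local_ring (res d) (res d ^ 2)"
    if "c \<in> {c1, c2, c3}" "d \<in> {c1, c2, c3}" "res c \<noteq> res d" for c d
  proof (rule local_rings_distinct[OF pt[OF that(1)] pt[OF that(2)]])
    show "e1 - c \<in> R" using roots[OF that(1)] by (auto simp: R_intros)
  qed (use roots[OF that(1)] that(3) in \<open>auto simp: phi_linear\<close>)
  let ?vs = "map (\<lambda>c. (local_ring (res c) (res c ^ 2), 1 :: nat)) [c1, c2, c3]"
  have "splits_as K E F (nonunits A) (map (\<lambda>(V, e). (nonunits V, e)) ?vs)"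
  proof (rule splits_asI[OF base K])
    show "distinct (map fst ?vs)" using dist distinct by simp
    fix W assume W: "valuation_ring K F W" "nonunits A \<subseteq> nonunits W"
    note over = valuation_ring_over[OF W]
    interpret W: valuation_subring F W by (rule over)
    have vieta: "res c1 + res c2 + res c3 = 0"
      "res c1 * res c2 + res c1 * res c3 + res c2 * res c3 = - res \<alpha>" "res c1 * res c2 * res c3 = - res \<beta>"
      using vieta_cubic[of "res c1" "res \<alpha>" "res \<beta>" "res c2" "res c3"] roots distinct by auto
    \<comment> \<open>the coefficients by which the product of the \<open>e1 - c\<close> differs from the cubic at \<open>e1\<close>\<close>
    define s where "s = c1 + c2 + c3"
    define p where "p = c1 * c2 + c1 * c3 + c2 * c3 + \<alpha>"
    define q where "q = - (c1 * c2 * c3 + \<beta>)"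
    have "s \<in> A" "res s = 0" "p \<in> A" "res p = 0" "q \<in> A" "res q = 0"
      using A vieta by (simp_all add: s_def p_def q_def A_closed res_add res_mult res_minus res_diff)
    hence "s \<in> nonunits W" "p \<in> nonunits W" "q \<in> nonunits W" using res_eq_0 W by auto
    hence "s * (- e2) + p * e1 + q \<in> nonunits W"
      using over(3) by (intro W.nonunits_add W.nonunits_mult) (auto simp: R_intros)
    moreover have "(e1 - c1) * ((e1 - c2) * (e1 - c3)) = s * (- e2) + p * e1 + q"
    proof -
      have "e1 * e1 = e2" "e1 * e2 = \<alpha> * e1 - \<beta>" using table tau by simp_all
      thus ?thesis by (simp add: s_def p_def q_def algebra_simps)
    qed
    ultimately have prod: "(e1 - c1) * ((e1 - c2) * (e1 - c3)) \<in> nonunits W" by simp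
    have mem: "e1 - c1 \<in> W" "e1 - c2 \<in> W" "e1 - c3 \<in> W" "(e1 - c2) * (e1 - c3) \<in> W"
      using over(3) A by (auto intro!: subsetD[OF over(3)] simp: R_intros)
    have "e1 - c1 \<in> nonunits W \<or> e1 - c2 \<in> nonunits W \<or> e1 - c3 \<in> nonunits W"
      using W.nonunits_prime[OF prod mem(1,4)] W.nonunits_prime[OF _ mem(2,3)] by blast
    thus "W \<in> fst ` set ?vs"
      using residue_point.loc_unique[OF pt over(1-4)] zero_nonunit[OF W.V] by auto
  next
    fix V e assume "(V, e) \<in> set ?vs"
    thus "A \<subseteq> V \<and> (\<exists>\<pi> w. dvr F V \<pi> \<and> unit_in V w \<and> t = \<pi> ^ e * w)"
      using residue_point_facts[OF pt] by auto
  qed auto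
  thus ?thesis by simp
qed

end

text \<open>Multiplication by \<open>x \<noteq> 0\<close> permutes the nonzero elements and so preserves their product.\<close>

section \<open>Finite fields and roots of cubics over rational functions\<close>

lemma power_CARD_eq_self:
  fixes x :: "'k::{field,finite}"
  shows "x ^ CARD('k) = x"
proof (cases "x = 0")
  case False
  let ?S = "UNIV - {0 :: 'k}"
  have "(\<Prod>y\<in>?S. x * y) = \<Prod>?S"
    by (rule prod.reindex_bij_witness[of _ "\<lambda>y. y / x" "\<lambda>y. x * y"]) (use False in auto)
  hence "x ^ card ?S * \<Prod>?S = 1 * \<Prod>?S" by (simp add: prod.distrib)
  hence "x ^ card ?S = 1" by simp
  moreover have "CARD('k) = Suc (card ?S)" by (subst card.remove[of UNIV 0]) auto
  ultimately show ?thesis by (simp only: power_Suc mult_1_right)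
qed (simp add: zero_power)

text \<open>Translation by \<open>1\<close> permutes the field and so preserves the sum of all elements.\<close>

lemma of_nat_CARD_eq_0: "of_nat CARD('k) = (0 :: 'k::{field,finite})"
proof -
  have "(\<Sum>y\<in>UNIV. y + 1) = (\<Sum>y\<in>UNIV. y :: 'k)"
    by (rule sum.reindex_bij_witness[of _ "\<lambda>y. y - 1" "\<lambda>y. y + 1"]) auto
  thus ?thesis by (simp add: sum.distrib)
qed

text \<open>Integral closedness of the polynomial ring, by the conductor: the polynomials \<open>w\<close> for which \<open>w e\<close>
  and \<open>w e\<^sup>2\<close> are polynomials form a nonzero ideal, which multiplication by \<open>e\<close> maps into itself.
  If \<open>w\<close> generates it, then \<open>w e\<close> is a multiple of \<open>w\<close>.\<close>

lemma integral_cubic_root: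
  fixes e :: "'k::field poly fract"
  assumes e: "e ^ 3 = Fract A 1 * e - Fract B 1"
  shows "\<exists>h. e = Fract h 1"
proof -
  define J where "J w \<longleftrightarrow> (\<exists>p q. Fract w 1 * e = Fract p 1 \<and> Fract w 1 * e ^ 2 = Fract q 1)" for w
  obtain u v where uv: "e = Fract u v" "v \<noteq> 0" by (cases e) auto
  have "J (v ^ 2)" unfolding J_def
    by (rule exI[of _ "u * v"], rule exI[of _ "u ^ 2"]) (use uv in \<open>simp add: eq_fract power2_eq_square\<close>)
  hence ex: "J (v ^ 2) \<and> v ^ 2 \<noteq> 0" using uv by simp
  obtain w where w: "J w" "w \<noteq> 0" and minimal: "\<And>w'. J w' \<Longrightarrow> w' \<noteq> 0 \<Longrightarrow> degree w \<le> degree w'"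
    using ex_has_least_nat[of "\<lambda>w. J w \<and> w \<noteq> 0", OF ex, of degree] by blast
  obtain p q where pq: "Fract w 1 * e = Fract p 1" "Fract w 1 * e ^ 2 = Fract q 1"
    using w unfolding J_def by blast
  define r where "r = p mod w"
  have r: "r = p - (p div w) * w" by (simp add: r_def minus_div_mult_eq_mod)
  have "Fract p 1 * e = Fract q 1"
    unfolding pq[symmetric] by (simp add: power2_eq_square)
  moreover have "Fract p 1 * e ^ 2 = Fract (A * p - B * w) 1"
  proof -
    have "Fract p 1 * e ^ 2 = Fract w 1 * e ^ 3"
      unfolding pq(1)[symmetric] by (simp add: power2_eq_square power3_eq_cube)
    also have "\<dots> = Fract A 1 * (Fract w 1 * e) - Fract B 1 * Fract w 1"
      unfolding e by (simp add: algebra_simps)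
    finally show ?thesis unfolding pq by simp
  qed
  moreover have Fr: "Fract r 1 = Fract p 1 - Fract (p div w) 1 * Fract w 1" by (subst r) simp
  ultimately have "Fract r 1 * e = Fract (q - (p div w) * p) 1"
    "Fract r 1 * e ^ 2 = Fract (A * p - B * w - (p div w) * q) 1"
    unfolding Fr left_diff_distrib mult.assoc pq by simp_all
  hence "J r" unfolding J_def by blast
  have "r = 0"
  proof (rule ccontr)
    assume "r \<noteq> 0"
    hence "degree r < degree w" using w degree_mod_less[of w p] by (auto simp: r_def)
    thus False using minimal[OF \<open>J r\<close> \<open>r \<noteq> 0\<close>] by simp
  qed
  hence "p = (p div w) * w" using r by simp
  hence "Fract w 1 * e = Fract w 1 * Fract (p div w) 1" using pq by (simp add: mult.commute)
  moreover have "Fract w 1 \<noteq> 0" using w by (simp add: eq_fract Zero_fract_def)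
  ultimately have "e = Fract (p div w) 1" by (metis mult_left_cancel)
  thus ?thesis by blast
qed

lemma map_poly_to_ac_hom:
  shows "map_poly to_ac (p * q) = map_poly to_ac p * map_poly to_ac q"
    and "map_poly to_ac (p - q) = map_poly to_ac p - map_poly to_ac q"
  by (auto intro!: poly_eqI simp: coeff_map_poly coeff_mult to_ac_sum)

text \<open>A polynomial root \<open>h\<close> splits off the factor \<open>T - h\<close>, also over the algebraic closure.\<close>

lemma absolutely_irreducible_no_root:
  assumes "absolutely_irreducible (cubic A B)"
  shows "h ^ 3 \<noteq> A * h - B"
proof
  assume h: "h ^ 3 = A * h - B"
  define a b c where "a = map_poly to_ac A" and "b = map_poly to_ac B" and "c = map_poly to_ac h"
  have "map_poly to_ac (h * (h * h)) = map_poly to_ac (A * h - B)" using h by (simp add: power3_eq_cube mult.assoc)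
  hence c: "c * (c * c) = a * c - b" unfolding map_poly_to_ac_hom a_def b_def c_def .
  have "map_poly (map_poly to_ac) (cubic A B) = cubic a b"
  proof -
    have "map_poly to_ac (- A) = - a" by (auto intro!: poly_eqI simp: coeff_map_poly a_def)
    thus ?thesis unfolding cubic_def a_def b_def
      by (auto intro!: poly_eqI simp: coeff_map_poly coeff_pCons split: nat.splits)
  qed
  moreover have "cubic a b = [:- c, 1:] * [:c * c - a, c, 1:]"
    using c by (simp add: cubic_def algebra_simps)
  ultimately have "irreducible ([:- c, 1:] * [:c * c - a, c, 1:])"
    using assms by (simp add: absolutely_irreducible_def)
  from irreducibleD[OF this refl] show False by (auto simp: is_unit_poly_iff)
qed

section \<open>The valuation ring at infinity\<close>

lemma span3_scale:
  assumes S: "is_subfield S" and s: "s \<in> S" "s \<noteq> 0"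
  shows "span3 S (y * s) ((y * s) ^ 2) = span3 S y (y ^ 2)"
proof -
  note cl = is_subring_closed[OF is_subfield_closed(1)[OF S]] is_subfield_closed(3)[OF S]
  show ?thesis
  proof (intro equalityI subsetI)
    fix z assume "z \<in> span3 S (y * s) ((y * s) ^ 2)"
    then obtain a b c where "a \<in> S" "b \<in> S" "c \<in> S" "z = a + b * (y * s) + c * (y * s) ^ 2" by (rule span3E)
    thus "z \<in> span3 S y (y ^ 2)" using s
      by (intro span3I[of a _ "b * s" "c * s ^ 2"]) (auto simp: cl power_mult_distrib)
  next
    fix z assume "z \<in> span3 S y (y ^ 2)"
    then obtain a b c where "a \<in> S" "b \<in> S" "c \<in> S" "z = a + b * y + c * y ^ 2" by (rule span3E)
    thus "z \<in> span3 S (y * s) ((y * s) ^ 2)" using s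
      by (intro span3I[of a _ "b / s" "c / s ^ 2"]) (auto simp: cl power_mult_distrib)
  qed
qed

locale rational_embedding =
  fixes \<iota> :: "'k::{field,finite} poly fract \<Rightarrow> 'l::field"
  assumes hom: "\<iota> \<in> ring_hom ring_of_type_algebra ring_of_type_algebra"
begin

lemma iota_add: "\<iota> (a + b) = \<iota> a + \<iota> b" and iota_mult: "\<iota> (a * b) = \<iota> a * \<iota> b" and iota_one: "\<iota> 1 = 1"
  using hom by (auto simp: ring_hom_def ring_of_type_algebra_def)

lemma iota_zero: "\<iota> 0 = 0"
  using iota_add[of 0 0] by (metis add_0_right add_cancel_left_right)

lemma iota_diff: "\<iota> (a - b) = \<iota> a - \<iota> b"
  using iota_add[of "a - b" b] by simp

lemma iota_eq_0_iff: "\<iota> a = 0 \<longleftrightarrow> a = 0"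
  using iota_mult[of a "inverse a"] by (cases "a = 0") (auto simp: iota_zero iota_one)

lemma iota_inverse: "\<iota> (inverse a) = inverse (\<iota> a)"
proof (cases "a = 0")
  case False
  hence "\<iota> a * \<iota> (inverse a) = 1" by (simp add: iota_one flip: iota_mult)
  thus ?thesis by (rule inverse_unique[symmetric])
qed (simp add: iota_zero)

lemma iota_eq_iff: "\<iota> a = \<iota> b \<longleftrightarrow> a = b"
  using iota_eq_0_iff[of "a - b"] by (simp add: iota_diff)

lemma subfield_range: "is_subfield (range \<iota>)"
  unfolding is_subfield_def is_subring_def
  by (auto simp flip: iota_one iota_diff iota_mult iota_inverse)

definition emb :: "'k poly \<Rightarrow> 'l" where "emb f = \<iota> (Fract f 1)"

lemma emb_hom: "emb (f + g) = emb f + emb g" "emb (f - g) = emb f - emb g" "emb (f * g) = emb f * emb g" "emb 1 = 1" "emb 0 = 0"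
  unfolding emb_def
  by (simp_all add: iota_one iota_zero fract_collapse flip: iota_add iota_diff iota_mult)

lemma emb_eq_iff: "emb f = emb g \<longleftrightarrow> f = g"
  by (simp add: emb_def iota_eq_iff eq_fract)

lemma emb_eq_0_iff: "emb f = 0 \<longleftrightarrow> f = 0"
  using emb_eq_iff[of f 0] by (simp add: emb_hom)

lemma emb_power: "emb (f ^ n) = emb f ^ n"
  by (induction n) (simp_all add: emb_hom)

lemma iota_Fract: "g \<noteq> 0 \<Longrightarrow> \<iota> (Fract f g) = emb f / emb g"
proof -
  assume g: "g \<noteq> 0"
  have "\<iota> (Fract f g) * emb g = emb f" unfolding emb_def using g by (simp add: iota_eq_iff eq_fract flip: iota_mult)
  thus ?thesis using g emb_eq_0_iff by (simp add: field_simps)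
qed

lemma range_iota: "range \<iota> = {emb f / emb g |f g. g \<noteq> 0}"
proof (intro equalityI subsetI)
  fix z assume "z \<in> range \<iota>"
  then obtain a where "z = \<iota> a" by blast
  moreover obtain f g where "a = Fract f g" "g \<noteq> 0" by (cases a) auto
  ultimately show "z \<in> {emb f / emb g |f g. g \<noteq> 0}" using iota_Fract by blast
next
  fix z assume "z \<in> {emb f / emb g |f g. g \<noteq> 0}"
  then obtain f g where "z = emb f / emb g" "g \<noteq> 0" by blast
  hence "z = \<iota> (Fract f g)" by (simp add: iota_Fract)
  thus "z \<in> range \<iota>" by blast
qed

lemma infinite_place_eq: "infinite_place \<iota> = {emb f / emb g |f g. g \<noteq> 0 \<and> degree f < degree g}"
  unfolding infinite_place_def by (intro Collect_cong) (auto simp: iota_Fract, (metis iota_Fract)+)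

definition t :: 'l where "t = inverse (emb [:0, 1:])"

text \<open>The rational functions of degree at most \<open>0\<close>, as the valuation ring recovered from the infinite
  place.\<close>

definition Oinf :: "'l set" where "Oinf = place_ring (range \<iota>) (infinite_place \<iota>)"

lemma Oinf_valuation: "valuation_ring (constants \<iota>) (range \<iota>) Oinf" "nonunits Oinf = infinite_place \<iota>"
proof -
  obtain V where V: "valuation_ring (constants \<iota>) (range \<iota>) V" "infinite_place \<iota> = nonunits V"
    using infinite_place_is_place(1)[OF hom] by (auto simp: place_iff)
  have "Oinf = V" unfolding Oinf_def V(2) by (rule place_ring_nonunits[OF V(1)])
  thus "valuation_ring (constants \<iota>) (range \<iota>) Oinf" "nonunits Oinf = infinite_place \<iota>" using V by auto
qed

sublocale inf: valuation_subring "range \<iota>" Oinf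
  using Oinf_valuation(1) valuation_ring_iff[OF subfield_range] by blast

lemma constants_Oinf: "constants \<iota> \<subseteq> Oinf"
  using Oinf_valuation(1) valuation_ring_iff[OF subfield_range] by blast

lemma constants_eq: "constants \<iota> = range (\<lambda>c. emb [:c:])"
  by (simp add: constants_def emb_def)

lemma quotient_mem_Oinf:
  assumes g: "g \<noteq> 0" and deg: "degree f \<le> degree g"
  shows "emb f / emb g \<in> Oinf"
proof (cases "f = 0")
  case True
  thus ?thesis using is_subring_closed(2)[OF inf.V] by (simp add: emb_hom)
next
  case False
  have "inverse (emb f / emb g) \<notin> infinite_place \<iota>"
  proof
    assume "inverse (emb f / emb g) \<in> infinite_place \<iota>"
    then obtain f' g' where *: "emb g / emb f = emb f' / emb g'" "g' \<noteq> 0" "degree f' < degree g'"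
      unfolding infinite_place_eq by auto
    hence "emb (g * g') = emb (f' * f)" using False emb_eq_0_iff by (simp add: emb_hom field_simps)
    hence eq: "g * g' = f' * f" by (simp only: emb_eq_iff)
    hence "f' \<noteq> 0" using g * by auto
    hence "degree g + degree g' = degree f' + degree f"
      using arg_cong[OF eq, of degree] g * False by (simp add: degree_mult_eq)
    thus False using * deg by simp
  qed
  moreover have "emb f / emb g \<in> range \<iota>" unfolding range_iota using g by blast
  ultimately show ?thesis by (simp add: Oinf_def place_ring_def)
qed

lemma mem_OinfE:
  assumes "z \<in> Oinf"
  obtains f g where "g \<noteq> 0" "degree f \<le> degree g" "z = emb f / emb g"
proof -
  obtain f g where fg: "g \<noteq> 0" "z = emb f / emb g" using assms inf.VF unfolding range_iota by blast
  show ?thesis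
  proof (cases "degree f \<le> degree g")
    case False
    hence f: "f \<noteq> 0" "degree g < degree f" by auto
    have "inverse z = emb g / emb f" by (simp add: fg)
    hence "inverse z \<in> infinite_place \<iota>" using f unfolding infinite_place_eq by blast
    moreover have "z \<noteq> 0" using f fg by (simp add: emb_eq_0_iff)
    moreover have "z = 0 \<or> inverse z \<notin> infinite_place \<iota>"
      using assms unfolding Oinf_def place_ring_def by blast
    ultimately show ?thesis by blast
  qed (use fg that in auto)
qed

lemma nonunit_quotient:
  assumes "g \<noteq> 0" "f = 0 \<or> degree f < degree g"
  shows "emb f / emb g \<in> nonunits Oinf"
proof (cases "f = 0")
  case True
  thus ?thesis using is_subring_closed(2)[OF inf.V] by (simp add: emb_hom nonunits_def)
qed (use assms in \<open>auto simp: Oinf_valuation infinite_place_eq\<close>)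

lemma t_power: "t ^ m = 1 / emb (monom 1 m)"
proof -
  have "t ^ m = 1 / emb ([:0, 1:] ^ m)" by (simp add: t_def emb_power divide_inverse power_inverse)
  thus ?thesis by (simp add: monom_altdef)
qed

text \<open>A nonzero polynomial of degree \<open>m\<close> is \<open>1 / t ^ m\<close> times a unit, its quotient by \<open>x ^ m\<close>.\<close>

lemma dvr_inf: "dvr (range \<iota>) Oinf t"
proof
  have t: "t = emb 1 / emb [:0, 1:]" by (simp add: t_def emb_hom divide_inverse)
  have "t \<in> nonunits Oinf" unfolding t by (rule nonunit_quotient) auto
  moreover have "t \<noteq> 0" unfolding t by (simp add: emb_eq_0_iff)
  ultimately show "t \<in> Oinf" "inverse t \<notin> Oinf" by (auto simp: nonunits_def)
  fix z assume z: "z \<in> range \<iota>" "z \<noteq> 0"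
  then obtain f g where fg: "g \<noteq> 0" "z = emb f / emb g" unfolding range_iota by blast
  hence f: "f \<noteq> 0" using z emb_eq_0_iff by auto
  have unit: "unit_in Oinf (emb h * t ^ degree h)" if h: "h \<noteq> 0" for h
  proof -
    have m: "monom (1::'k) (degree h) \<noteq> 0" "degree (monom (1::'k) (degree h)) = degree h"
      by (simp_all add: monom_eq_0_iff degree_monom_eq)
    have "emb h / emb (monom 1 (degree h)) \<in> Oinf" "emb (monom 1 (degree h)) / emb h \<in> Oinf"
      using quotient_mem_Oinf[OF m(1), of h] quotient_mem_Oinf[OF h, of "monom 1 (degree h)"] m by auto
    thus ?thesis using h m emb_eq_0_iff by (auto simp: unit_in_def t_power)
  qed
  have "z = t powi (int (degree g) - int (degree f)) *
      ((emb f * t ^ degree f) * inverse (emb g * t ^ degree g))"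
    using fg \<open>t \<noteq> 0\<close> by (simp add: power_int_diff field_simps)
  thus "\<exists>n u. unit_in Oinf u \<and> z = t powi n * u"
    using unit_in_mult[OF inf.V unit[OF f] unit_in_inverse[OF unit[OF fg(1)]]] by blast
qed (use subfield_range inf.V inf.VF in auto)

text \<open>Subtracting \<open>c\<close> times the denominator cancels the only numerator coefficient of degree
  \<open>degree g\<close>.\<close>

lemma residue_exists:
  assumes "g \<noteq> 0" "degree f \<le> degree g"
  shows "emb f / emb g - emb [:coeff f (degree g) / lead_coeff g:] \<in> nonunits Oinf"
proof -
  define c where "c = coeff f (degree g) / lead_coeff g"
  define h where "h = f - smult c g"
  have lc: "lead_coeff g \<noteq> 0" using assms by simp
  have "degree h \<le> degree g" unfolding h_def using assms by (intro degree_diff_le) auto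
  moreover have "coeff h (degree g) = 0" using lc by (simp add: h_def c_def)
  ultimately have "h = 0 \<or> degree h < degree g"
    by (metis le_neq_implies_less leading_coeff_0_iff)
  hence "emb h / emb g \<in> nonunits Oinf" using assms nonunit_quotient by blast
  moreover have "emb h = emb f - emb [:c:] * emb g" by (simp add: h_def flip: emb_hom)
  ultimately show ?thesis using assms emb_eq_0_iff by (simp add: c_def diff_divide_distrib)
qed

lemma constant_nonunit_iff: "emb [:c:] \<in> nonunits Oinf \<longleftrightarrow> c = 0"
proof
  assume c: "emb [:c:] \<in> nonunits Oinf"
  show "c = 0"
  proof (rule ccontr)
    assume "c \<noteq> 0"
    have "inverse c \<noteq> 0" using \<open>c \<noteq> 0\<close> by simp
    have "emb [:inverse c:] \<in> Oinf" using constants_Oinf by (auto simp: constants_eq)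
    hence "emb [:c:] * emb [:inverse c:] \<in> nonunits Oinf" using inf.nonunits_mult c by blast
    moreover have "emb [:c:] * emb [:inverse c:] = 1" using \<open>c \<noteq> 0\<close> emb_hom(4) by (simp add: one_pCons flip: emb_hom(3))
    ultimately show False using inf.one_notin_nonunits by simp
  qed
qed (use nonunit_quotient[of 1 0] in \<open>simp add: emb_hom\<close>)

definition residue :: "'l \<Rightarrow> 'k" where
  "residue z = (THE c. z - emb [:c:] \<in> nonunits Oinf)"

lemma residueI:
  assumes "z - emb [:c:] \<in> nonunits Oinf"
  shows "residue z = c"
  unfolding residue_def
proof (rule the_equality)
  fix d assume d: "z - emb [:d:] \<in> nonunits Oinf"
  have "(z - emb [:c:]) + (z - emb [:d:]) * (- 1) \<in> nonunits Oinf"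
    using assms d inf.V by (intro inf.nonunits_add inf.nonunits_mult) (auto simp: is_subring_closed)
  moreover have "(z - emb [:c:]) + (z - emb [:d:]) * (- 1) = emb [:d - c:]"
  proof -
    have "emb [:d - c:] = emb [:d:] - emb [:c:]" by (simp flip: emb_hom)
    thus ?thesis by simp
  qed
  ultimately show "d = c" using constant_nonunit_iff[of "d - c"] by simp
qed (rule assms)

lemma residue_mem:
  assumes "z \<in> Oinf"
  shows "z - emb [:residue z:] \<in> nonunits Oinf"
proof -
  obtain f g where "g \<noteq> 0" "degree f \<le> degree g" "z = emb f / emb g" using assms by (rule mem_OinfE)
  hence *: "z - emb [:coeff f (degree g) / lead_coeff g:] \<in> nonunits Oinf" using residue_exists by simp
  thus ?thesis using residueI[OF *] by simp
qed

lemma residue_constant: "residue (emb [:c:]) = c"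
  using constant_nonunit_iff[of 0] by (intro residueI) (simp add: emb_hom)

lemma residue_add:
  assumes "x \<in> Oinf" "z \<in> Oinf"
  shows "residue (x + z) = residue x + residue z"
proof (rule residueI)
  have "(x - emb [:residue x:]) + (z - emb [:residue z:]) \<in> nonunits Oinf"
    using assms residue_mem by (intro inf.nonunits_add)
  moreover have "emb [:residue x + residue z:] = emb [:residue x:] + emb [:residue z:]" by (simp flip: emb_hom)
  ultimately show "x + z - emb [:residue x + residue z:] \<in> nonunits Oinf" by (simp add: algebra_simps)
qed

lemma residue_mult:
  assumes "x \<in> Oinf" "z \<in> Oinf"
  shows "residue (x * z) = residue x * residue z"
proof (rule residueI)
  have "emb [:residue x:] \<in> Oinf" using constants_Oinf by (auto simp: constants_eq)
  hence "(x - emb [:residue x:]) * z + (z - emb [:residue z:]) * emb [:residue x:] \<in> nonunits Oinf"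
    using assms residue_mem by (intro inf.nonunits_add inf.nonunits_mult)
  moreover have "emb [:residue x * residue z:] = emb [:residue x:] * emb [:residue z:]"
    by (simp add: mult.commute flip: emb_hom)
  ultimately show "x * z - emb [:residue x * residue z:] \<in> nonunits Oinf" by (simp add: algebra_simps)
qed

lemma residue_eq_0_iff:
  assumes "x \<in> Oinf"
  shows "residue x = 0 \<longleftrightarrow> x \<in> nonunits Oinf"
  using residue_mem[OF assms] residueI[of x 0] by (auto simp: emb_hom)

lemma residue_normalized:
  assumes "degree f \<le> m"
  shows "emb f * t ^ m \<in> Oinf" "residue (emb f * t ^ m) = coeff f m"
proof -
  have m: "monom (1::'k) m \<noteq> 0" "degree (monom (1::'k) m) = m"
    by (simp_all add: monom_eq_0_iff degree_monom_eq)
  have eq: "emb f * t ^ m = emb f / emb (monom 1 m)" by (simp add: t_power)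
  show "emb f * t ^ m \<in> Oinf" unfolding eq using m assms by (intro quotient_mem_Oinf) auto
  show "residue (emb f * t ^ m) = coeff f m"
    unfolding eq using residue_exists[OF m(1), of f] m assms by (intro residueI) auto
qed

end

section \<open>The places above infinity\<close>

lemma poly_cubic_eq_0_iff:
  fixes a b c :: "'b::field"
  shows "poly (cubic a b) c = 0 \<longleftrightarrow> c ^ 3 = a * c - b"
proof -
  have "poly (cubic a b) c = c ^ 3 - (a * c - b)" by (simp add: cubic_def power3_eq_cube algebra_simps)
  thus ?thesis by simp
qed

locale infinity_cubic = rational_embedding \<iota>
  for \<iota> :: "'k::{field,finite} poly fract \<Rightarrow> 'l::field" +
  fixes A B :: "'k poly" and y :: 'l
  assumes A_nz: "A \<noteq> 0" and irred: "absolutely_irreducible (cubic A B)"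
    and y: "y ^ 3 - \<iota> (Fract A 1) * y + \<iota> (Fract B 1) = 0"
begin

sublocale gen: cubic_over "range \<iota>" "emb A" "emb B" y
proof
  show "y ^ 3 = emb A * y - emb B" using y by (simp add: emb_def algebra_simps add_eq_0_iff)
  fix s assume "s \<in> range \<iota>"
  then obtain e where e: "s = \<iota> e" by blast
  show "s ^ 3 \<noteq> emb A * s - emb B"
  proof
    assume "s ^ 3 = emb A * s - emb B"
    hence "\<iota> (e ^ 3) = \<iota> (Fract A 1 * e - Fract B 1)"
      by (simp add: e emb_def iota_mult iota_diff power3_eq_cube)
    hence eq: "e ^ 3 = Fract A 1 * e - Fract B 1" by (simp only: iota_eq_iff)
    then obtain h where h: "e = Fract h 1" using integral_cubic_root by blast
    hence "h ^ 3 = A * h - B" using eq by (simp add: eq_fract power3_eq_cube)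
    thus False using absolutely_irreducible_no_root[OF irred] by blast
  qed
qed (use subfield_range in \<open>auto simp: emb_def\<close>)

lemma adjoin_root_eq: "adjoin_root \<iota> y = span3 (range \<iota>) y (y ^ 2)"
  unfolding adjoin_root_def by (rule gen.generate_field_eq)

lemma infinity_splits_as_iff:
  "infinity_splits_as \<iota> y ps \<longleftrightarrow>
    splits_as (constants \<iota>) (range \<iota>) (span3 (range \<iota>) y (y ^ 2)) (nonunits Oinf) ps"
  by (simp add: infinity_splits_as_def adjoin_root_eq Oinf_valuation)

lemma subfield_constants: "is_subfield (constants \<iota>)"
proof -
  have inv: "inverse (emb [:c:]) = emb [:inverse c:]" for c
  proof (cases "c = 0")
    case False
    hence "emb [:c:] * emb [:inverse c:] = 1" using emb_hom(4) by (simp add: one_pCons flip: emb_hom(3))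
    thus ?thesis by (rule inverse_unique)
  qed (simp add: emb_hom)
  have "1 = emb [:1:]" using emb_hom(4) by (simp add: one_pCons)
  moreover have "emb [:c:] - emb [:d:] = emb [:c - d:]" "emb [:c:] * emb [:d:] = emb [:c * d:]" for c d
    by (simp_all add: mult.commute flip: emb_hom)
  ultimately show ?thesis
    unfolding is_subfield_def is_subring_def constants_eq using inv by auto
qed

abbreviation res :: "'l \<Rightarrow> 'k alg_closure" where "res z \<equiv> to_ac (residue z)"

text \<open>Multiplication of \<open>y ^ 3 - A y + B = 0\<close> by \<open>\<tau> t ^ (3 n)\<close> gives the equation of
  \<open>y t ^ n\<close>.\<close>

lemma cubic_order:
  assumes tau: "\<tau> \<in> Oinf" "\<tau> \<noteq> 0"
    and al: "\<tau> * (emb A * t ^ (2 * n)) \<in> Oinf" and be: "\<tau> * (emb B * t ^ (3 * n)) \<in> Oinf"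
  shows "cubic_order (range \<iota>) Oinf (span3 (range \<iota>) y (y ^ 2)) (constants \<iota>) t
    (y * t ^ n) \<tau> (\<tau> * (emb A * t ^ (2 * n))) (\<tau> * (emb B * t ^ (3 * n))) res"
proof (rule cubic_order.intro)
  interpret inf: dvr "range \<iota>" Oinf t by (rule dvr_inf)
  note cl = is_subring_closed[OF is_subfield_closed(1)[OF subfield_range]]
  have tn: "t ^ n \<in> range \<iota>" "t ^ n \<noteq> 0" using inf.pi_mem inf.VF inf.pi_nz cl(7) by auto
  show "span3 (range \<iota>) y (y ^ 2) = span3 (range \<iota>) (y * t ^ n) ((y * t ^ n) ^ 2)"
    by (rule span3_scale[OF subfield_range tn, symmetric])
  show "u = 0 \<and> v = 0 \<and> w = 0"
    if uvw: "u \<in> range \<iota>" "v \<in> range \<iota>" "w \<in> range \<iota>" "u + v * (y * t ^ n) + w * (y * t ^ n) ^ 2 = 0" for u v w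
  proof -
    have "u + (v * t ^ n) * y + (w * (t ^ n) ^ 2) * y ^ 2 = 0"
      using uvw(4) by (simp add: power_mult_distrib algebra_simps)
    moreover have "v * t ^ n \<in> range \<iota>" "w * (t ^ n) ^ 2 \<in> range \<iota>" using uvw tn cl by (simp_all only:)
    ultimately have "u = 0 \<and> v * t ^ n = 0 \<and> w * (t ^ n) ^ 2 = 0" using gen.indep uvw(1) by blast
    thus ?thesis using inf.pi_nz by simp
  qed
  have "\<tau> * (y * t ^ n) ^ 3 = \<tau> * (emb A * y - emb B) * t ^ (3 * n)"
    by (simp add: power_mult_distrib gen.y mult.commute flip: power_mult)
  also have "\<dots> = \<tau> * (emb A * t ^ (2 * n)) * (y * t ^ n) - \<tau> * (emb B * t ^ (3 * n))"
    by (simp add: algebra_simps flip: power_add)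
  finally show "\<tau> * (y * t ^ n) ^ 3 = \<tau> * (emb A * t ^ (2 * n)) * (y * t ^ n) - \<tau> * (emb B * t ^ (3 * n))" .
  show "res 1 = 1" using residue_constant[of 1] by (simp add: emb_hom flip: one_pCons)
  show "\<exists>c\<in>constants \<iota>. x - c \<in> nonunits Oinf" if "x \<in> Oinf" for x
    using residue_mem[OF that] by (auto simp: constants_eq)
  show "finite (res ` Oinf)"
    by (rule finite_subset[of _ "range to_ac"]) auto
qed (use dvr_inf subfield_constants constants_Oinf gen.subfield_span tau al be
      in \<open>auto simp: residue_add residue_mult residue_eq_0_iff\<close>)

lemma t_Oinf: "t \<in> Oinf" "t \<noteq> 0" "residue t = 0"
proof -
  interpret inf: dvr "range \<iota>" Oinf t by (rule dvr_inf)
  show "t \<in> Oinf" "t \<noteq> 0" by (rule inf.pi_mem inf.pi_nz)+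
  thus "residue t = 0" using inf.pi_nonunit residue_eq_0_iff by blast
qed

text \<open>At a place above infinity \<open>y\<close> has valuation \<open>- degree B / 3\<close> times that of \<open>t\<close>; the exponent
  \<open>n\<close> is the integer nearest to \<open>degree B / 3\<close>. If \<open>y t ^ n\<close> is integral, the choice \<open>\<tau> = 1\<close>
  gives the Eisenstein case. Otherwise \<open>\<tau> = t\<close> moves the triple zero to infinity.\<close>

lemma splits_totally_ramified:
  assumes "\<not> 3 dvd degree B" "3 * degree A < 2 * degree B"
  shows "\<exists>\<pp>. infinity_splits_as \<iota> y [(\<pp>, 3)]"
proof -
  have B_nz: "B \<noteq> 0" using assms by auto
  define n where "n = (degree B + 1) div 3"
  have "degree B mod 3 = 1 \<or> degree B mod 3 = 2" using assms by presburger
  hence "degree B = 3 * n + 1 \<or> degree B + 1 = 3 * n" unfolding n_def by presburger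
  thus ?thesis
  proof
    assume n: "degree B = 3 * n + 1"
    hence A: "degree A \<le> 2 * n" using assms by linarith
    have al: "t * (emb A * t ^ (2 * n)) = emb A * t ^ (2 * n + 1)"
      and be: "t * (emb B * t ^ (3 * n)) = emb B * t ^ (3 * n + 1)" by simp_all
    interpret C: cubic_order "range \<iota>" Oinf "span3 (range \<iota>) y (y ^ 2)" "constants \<iota>" t "y * t ^ n"
      t "emb A * t ^ (2 * n + 1)" "emb B * t ^ (3 * n + 1)" res
      using cubic_order[of t n] t_Oinf residue_normalized[of A "2 * n + 1"] residue_normalized[of B "3 * n + 1"] A n
      unfolding al be by simp
    have "coeff A (2 * n + 1) = 0" using A by (intro coeff_eq_0) simp
    moreover have "coeff B (3 * n + 1) \<noteq> 0" using n B_nz by (metis leading_coeff_0_iff)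
    ultimately have "res (emb A * t ^ (2 * n + 1)) = 0" "res (emb B * t ^ (3 * n + 1)) \<noteq> 0"
      using residue_normalized[of A "2 * n + 1"] residue_normalized[of B "3 * n + 1"] A n by simp_all
    from C.totally_ramified_at_infinity[OF refl this] show ?thesis
      unfolding infinity_splits_as_iff by blast
  next
    assume n: "degree B + 1 = 3 * n"
    hence A: "degree A + 1 \<le> 2 * n" using assms by linarith
    define m where "m = degree B"
    have m: "3 * n = Suc m" using n by (simp add: m_def)
    interpret C: cubic_order "range \<iota>" Oinf "span3 (range \<iota>) y (y ^ 2)" "constants \<iota>" t "y * t ^ n"
      1 "emb A * t ^ (2 * n)" "emb B * t ^ (3 * n)" res
      using cubic_order[of 1 n] is_subring_closed(1)[OF inf.V] residue_normalized[of A "2 * n"]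
        residue_normalized[of B "3 * n"] A n by simp
    have "coeff A (2 * n) = 0" using A by (intro coeff_eq_0) simp
    hence "res (emb A * t ^ (2 * n)) = 0" using residue_normalized[of A "2 * n"] A by simp
    moreover have "emb B * t ^ (3 * n) = t * (emb B * t ^ m)" by (simp add: m)
    moreover have "emb B * t ^ m \<in> Oinf" "res (emb B * t ^ m) \<noteq> 0"
      using residue_normalized[of B m] B_nz by (simp_all add: m_def)
    ultimately show ?thesis
      unfolding infinity_splits_as_iff using C.totally_ramified_at_zero[OF refl] by blast
  qed
qed

text \<open>With \<open>degree A = 2 n + 1\<close>, the coefficient \<open>A t ^ (2 n)\<close> in the equation of \<open>y t ^ n\<close> has a
  simple pole, which \<open>\<tau> = t\<close> removes. It becomes a unit, and the leading coefficient becomes a nonunit.\<close>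

lemma splits_partially_ramified:
  assumes "2 * degree B \<le> 3 * degree A" "odd (degree A)"
  shows "\<exists>\<pp> \<qq>. infinity_splits_as \<iota> y [(\<pp>, 1), (\<qq>, 2)]"
proof -
  obtain n where n: "degree A = 2 * n + 1" using assms(2) by (elim oddE)
  hence B: "degree B \<le> 3 * n + 1" using assms by linarith
  have al: "t * (emb A * t ^ (2 * n)) = emb A * t ^ (2 * n + 1)"
    and be: "t * (emb B * t ^ (3 * n)) = emb B * t ^ (3 * n + 1)" by simp_all
  interpret C: cubic_order "range \<iota>" Oinf "span3 (range \<iota>) y (y ^ 2)" "constants \<iota>" t "y * t ^ n"
    t "emb A * t ^ (2 * n + 1)" "emb B * t ^ (3 * n + 1)" res
    using cubic_order[of t n] t_Oinf residue_normalized[of A "2 * n + 1"] residue_normalized[of B "3 * n + 1"] n B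
    unfolding al be by simp
  have "coeff A (2 * n + 1) \<noteq> 0" using n A_nz by (metis leading_coeff_0_iff)
  hence "res (emb A * t ^ (2 * n + 1)) \<noteq> 0" using residue_normalized[of A "2 * n + 1"] n by simp
  from C.partially_ramified[OF refl this] show ?thesis
    unfolding infinity_splits_as_iff by blast
qed

end

text \<open>Here \<open>\<theta> = y t ^ n\<close> is integral and reduces to a root of \<open>T\<^sup>3 - a0 T + b0\<close>. In
  characteristic 3 the derivative of this polynomial is the nonzero constant \<open>- a0\<close>, so it is
  separable.\<close>

locale unramified_infinity_cubic = infinity_cubic \<iota> A B y
  for \<iota> :: "'k::{field,finite} poly fract \<Rightarrow> 'l::field" and A B y +
  fixes n :: nat
  assumes degrees: "2 * degree B \<le> 3 * degree A" "degree A = 2 * n"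
    and char3: "(3 :: 'k) = 0"
begin

abbreviation "a0 \<equiv> coeff A (2 * n)"
abbreviation "b0 \<equiv> coeff B (3 * n)"

lemma a0_nz: "a0 \<noteq> 0"
  using degrees A_nz by (metis leading_coeff_0_iff)

lemma normalized: "emb A * t ^ (2 * n) \<in> Oinf" "residue (emb A * t ^ (2 * n)) = a0"
    "emb B * t ^ (3 * n) \<in> Oinf" "residue (emb B * t ^ (3 * n)) = b0"
  using residue_normalized[of A "2 * n"] residue_normalized[of B "3 * n"] degrees by simp_all

sublocale order: cubic_order "range \<iota>" Oinf "span3 (range \<iota>) y (y ^ 2)" "constants \<iota>" t "y * t ^ n"
    1 "emb A * t ^ (2 * n)" "emb B * t ^ (3 * n)" res
  using cubic_order[of 1 n] is_subring_closed(1)[OF inf.V] normalized by simp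

lemma root_iff:
  "res z ^ 3 = res (emb A * t ^ (2 * n)) * res z - res (emb B * t ^ (3 * n)) \<longleftrightarrow> poly (cubic a0 b0) (residue z) = 0"
  unfolding poly_cubic_eq_0_iff normalized by (simp flip: to_ac_power to_ac_mult to_ac_diff)

lemma simple_root: "3 * res z ^ 2 \<noteq> res (emb A * t ^ (2 * n))"
proof -
  have "(3 :: 'k alg_closure) = 0" using char3 by (metis to_ac_numeral to_ac_0)
  thus ?thesis using a0_nz by (simp add: normalized)
qed

lemma constant_Oinf: "emb [:c:] \<in> Oinf"
  using constants_Oinf by (auto simp: constants_eq)

lemma splits_inert:
  assumes "\<And>c. poly (cubic a0 b0) c \<noteq> 0"
  shows "\<exists>\<pp>. infinity_splits_as \<iota> y [(\<pp>, 1)]"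
proof -
  obtain \<gamma> :: "'k alg_closure" where "poly (cubic (to_ac a0) (to_ac b0)) \<gamma> = 0"
    using alg_closed_imp_poly_has_root[of "cubic (to_ac a0) (to_ac b0)"] by (auto simp: cubic_def)
  hence "\<gamma> ^ 3 = res (emb A * t ^ (2 * n)) * \<gamma> - res (emb B * t ^ (3 * n))"
    by (simp add: poly_cubic_eq_0_iff normalized)
  from order.inert[OF refl this] assms show ?thesis
    unfolding infinity_splits_as_iff root_iff by blast
qed

text \<open>The second place comes from a root \<open>\<gamma>\<close> of the complementary quadratic factor in the algebraic
  closure. If \<open>\<gamma>\<close> were rational, it would equal \<open>c\<close>, which is a simple root.\<close>

lemma splits_one_root:
  assumes root: "poly (cubic a0 b0) c = 0" and unique: "\<And>c'. poly (cubic a0 b0) c' = 0 \<Longrightarrow> c' = c"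
  shows "\<exists>\<pp> \<qq>. infinity_splits_as \<iota> y [(\<pp>, 1), (\<qq>, 1)]"
proof -
  define z where "z = emb [:c:]"
  have z: "z \<in> Oinf" "residue z = c" using constant_Oinf residue_constant by (auto simp: z_def)
  define q where "q = [:c ^ 2 - a0, c, 1:]"
  obtain \<gamma> :: "'k alg_closure" where "poly (map_poly to_ac q) \<gamma> = 0"
    using alg_closed_imp_poly_has_root[of "map_poly to_ac q"] by (auto simp: q_def degree_map_poly)
  hence \<gamma>: "\<gamma> ^ 2 + res z * \<gamma> + (res z ^ 2 - res (emb A * t ^ (2 * n))) = 0"
    unfolding normalized z(2) by (simp add: q_def map_poly_pCons power2_eq_square algebra_simps)
  have "\<gamma> \<notin> res ` Oinf"
  proof
    assume "\<gamma> \<in> res ` Oinf"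
    then obtain x where x: "\<gamma> = to_ac x" by blast
    have "to_ac (x ^ 2 + c * x + (c ^ 2 - a0)) = 0" using \<gamma> by (simp add: x z normalized)
    hence q: "x ^ 2 + c * x + (c ^ 2 - a0) = 0" by (simp only: to_ac_eq_0_iff)
    have "poly (cubic a0 b0) x = poly (cubic a0 b0) c + (x - c) * (x ^ 2 + c * x + (c ^ 2 - a0))"
      by (simp add: cubic_def algebra_simps power2_eq_square)
    hence "poly (cubic a0 b0) x = 0" unfolding root q by simp
    hence "x = c" by (rule unique)
    have "3 * c ^ 2 - a0 = c ^ 2 + c * c + (c ^ 2 - a0)" by (simp add: power2_eq_square)
    also have "\<dots> = 0" using q unfolding \<open>x = c\<close> .
    finally show False using char3 a0_nz by simp
  qed
  from order.one_rational_root[OF refl z(1) _ simple_root \<gamma> this] show ?thesis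
    unfolding infinity_splits_as_iff root_iff using root z by blast
qed

lemma splits_three_roots:
  assumes roots: "poly (cubic a0 b0) c1 = 0" "poly (cubic a0 b0) c2 = 0" "poly (cubic a0 b0) c3 = 0"
    and distinct: "c1 \<noteq> c2" "c1 \<noteq> c3" "c2 \<noteq> c3"
  shows "\<exists>\<pp> \<qq> \<rr>. infinity_splits_as \<iota> y [(\<pp>, 1), (\<qq>, 1), (\<rr>, 1)]"
proof -
  have "splits_as (constants \<iota>) (range \<iota>) (span3 (range \<iota>) y (y ^ 2)) (nonunits Oinf)
    (map (\<lambda>c. (nonunits (order.local_ring (res c) (res c ^ 2)), 1)) [emb [:c1:], emb [:c2:], emb [:c3:]])"
    by (rule order.three_rational_roots[OF refl, unfolded root_iff])
      (use roots distinct simple_root constant_Oinf in \<open>auto simp: residue_constant\<close>)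
  thus ?thesis unfolding infinity_splits_as_iff by auto
qed

end

section \<open>Roots of the reduced cubic and the gcd\<close>

lemma poly_frobenius_diff: "poly (monom 1 CARD('k) - monom 1 1) (c :: 'k::{field,finite}) = 0"
  by (simp add: poly_monom power_CARD_eq_self)

text \<open>Every \<open>c\<close> in the finite field is a root of \<open>T ^ q - T\<close>, so \<open>T - c\<close> divides \<open>d\<close> if and only
  if it divides \<open>f\<close>.\<close>

lemma root_of_gcd_iff:
  fixes f :: "'k::{field,finite} poly"
  assumes "is_gcd d (monom 1 CARD('k) - monom 1 1) f"
  shows "poly d c = 0 \<longleftrightarrow> poly f c = 0"
  using assms poly_frobenius_diff[of c] unfolding is_gcd_def poly_eq_0_iff_dvd
  by (meson dvd_trans)

text \<open>All \<open>q\<close> elements of the field are roots of \<open>T ^ q - T\<close>, and the complementary factor of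
  degree \<open>q - degree f\<close> accounts for at most that many of them.\<close>

lemma rational_roots_of_divisor:
  fixes f :: "'k::{field,finite} poly"
  assumes "f dvd monom 1 CARD('k) - monom 1 1"
  shows "degree f \<le> card {c. poly f c = 0}"
proof -
  let ?p = "monom 1 CARD('k) - monom 1 1 :: 'k poly"
  obtain h where h: "?p = f * h" using assms by (elim dvdE)
  have q: "CARD('k) > 1"
    using card_mono[of "UNIV :: 'k set" "{0, 1}"] by simp
  have "coeff ?p CARD('k) = 1" using q by (simp add: coeff_diff)
  hence nz: "?p \<noteq> 0" by (metis coeff_0 zero_neq_one)
  hence fh: "f \<noteq> 0" "h \<noteq> 0" using h by auto
  have "degree ?p \<le> CARD('k)" using q by (intro degree_diff_le order.trans[OF degree_monom_le]) auto
  hence deg: "degree f + degree h \<le> CARD('k)" using h fh by (simp add: degree_mult_eq)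
  have "UNIV = {c. poly f c = 0} \<union> {c. poly h c = 0}"
    using poly_frobenius_diff[where 'k = 'k] unfolding h by auto
  hence "CARD('k) \<le> card {c. poly f c = 0} + card {c. poly h c = 0}"
    by (metis card_Un_le)
  moreover have "card {c. poly h c = 0} \<le> degree h" by (rule card_poly_roots_bound[OF fh(2)])
  ultimately show ?thesis using deg by linarith
qed

theorem theorem4p2:
  fixes A B :: "'k::{field,finite} poly"
    and \<iota> :: "'k poly fract \<Rightarrow> 'l::field"
    and y :: 'l
    and r :: nat
  assumes "CARD('k) = 3 ^ r"
    and "A \<noteq> 0"
    and "absolutely_irreducible (cubic A B)"
    and "\<iota> \<in> ring_hom ring_of_type_algebra ring_of_type_algebra"
    and "y ^ 3 - \<iota> (Fract A 1) * y + \<iota> (Fract B 1) = 0"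
    and "standard_form A B"
  shows
    "(\<not> 3 dvd degree B \<and> 2 * degree B > 3 * degree A \<longrightarrow>
        (\<exists>\<pp>. infinity_splits_as \<iota> y [(\<pp>, 3)]))
     \<and> (2 * degree B \<le> 3 * degree A \<and> odd (degree A) \<longrightarrow>
        (\<exists>\<pp> \<qq>. infinity_splits_as \<iota> y [(\<pp>, 1), (\<qq>, 2)]))
     \<and> (\<forall>n d. 2 * degree B \<le> 3 * degree A \<and> degree A = 2 * n \<and>
          is_gcd d (monom 1 CARD('k) - monom 1 1)
                   (cubic (coeff A (2 * n)) (coeff B (3 * n))) \<longrightarrow>
        (degree d = 0 \<longrightarrow> (\<exists>\<pp>. infinity_splits_as \<iota> y [(\<pp>, 1)])) \<and>
        (degree d = 1 \<longrightarrow> (\<exists>\<pp> \<qq>. infinity_splits_as \<iota> y [(\<pp>, 1), (\<qq>, 1)])) \<and>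
        (degree d = 3 \<longrightarrow> (\<exists>\<pp> \<qq> \<rr>. infinity_splits_as \<iota> y [(\<pp>, 1), (\<qq>, 1), (\<rr>, 1)])))"
proof -
  interpret infinity_cubic \<iota> A B y
    using assms by unfold_locales auto
  have char3: "(3 :: 'k) = 0"
    using of_nat_CARD_eq_0[where 'k = 'k] assms(1) by simp
  have unramified: "(degree d = 0 \<longrightarrow> (\<exists>\<pp>. infinity_splits_as \<iota> y [(\<pp>, 1)])) \<and>
      (degree d = 1 \<longrightarrow> (\<exists>\<pp> \<qq>. infinity_splits_as \<iota> y [(\<pp>, 1), (\<qq>, 1)])) \<and>
      (degree d = 3 \<longrightarrow> (\<exists>\<pp> \<qq> \<rr>. infinity_splits_as \<iota> y [(\<pp>, 1), (\<qq>, 1), (\<rr>, 1)]))"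
    if deg: "2 * degree B \<le> 3 * degree A" "degree A = 2 * n"
      and gcd: "is_gcd d (monom 1 CARD('k) - monom 1 1) (cubic (coeff A (2 * n)) (coeff B (3 * n)))" for n d
  proof -
    let ?f = "cubic (coeff A (2 * n)) (coeff B (3 * n))"
    interpret unramified_infinity_cubic \<iota> A B y n
      using deg char3 by unfold_locales
    note root_iff = root_of_gcd_iff[OF gcd]
    have f: "?f \<noteq> 0" "degree ?f = 3" by (simp_all add: cubic_def)
    have d_nz: "d \<noteq> 0" using gcd f by (auto simp: is_gcd_def)
    show ?thesis
    proof (intro conjI impI)
      assume "degree d = 0"
      then obtain u where "d = [:u:]" by (rule degree_eq_zeroE)
      hence "poly d c \<noteq> 0" for c using d_nz by simp
      thus "\<exists>\<pp>. infinity_splits_as \<iota> y [(\<pp>, 1)]" using root_iff by (intro splits_inert) auto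
    next
      assume "degree d = 1"
      obtain u e where e: "d = pCons u e" by (cases d) auto
      with \<open>degree d = 1\<close> have "e \<noteq> 0" "degree e = 0" by (auto split: if_splits)
      then obtain v where uv: "d = [:u, v:]" "v \<noteq> 0" using e by (auto elim!: degree_eq_zeroE)
      have "poly d c = 0 \<longleftrightarrow> c = - u / v" for c
        using uv by (auto simp: field_simps eq_neg_iff_add_eq_0 add.commute)
      thus "\<exists>\<pp> \<qq>. infinity_splits_as \<iota> y [(\<pp>, 1), (\<qq>, 1)]"
        using root_iff by (intro splits_one_root[of "- u / v"]) auto
    next
      assume d3: "degree d = 3"
      obtain h where h: "?f = d * h" using gcd by (auto simp: is_gcd_def elim: dvdE)
      hence "h \<noteq> 0" using f by auto
      hence "degree h = 0" using h f d3 d_nz degree_mult_eq[of d h] by simp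
      hence "is_unit h" using \<open>h \<noteq> 0\<close> by (simp add: is_unit_iff_degree)
      hence "?f dvd d" unfolding h by (simp add: mult_unit_dvd_iff)
      hence "?f dvd monom 1 CARD('k) - monom 1 1" using gcd by (auto simp: is_gcd_def intro: dvd_trans)
      hence "3 \<le> card {c. poly ?f c = 0}" using rational_roots_of_divisor f by metis
      then obtain T where "T \<subseteq> {c. poly ?f c = 0}" "card T = 3"
        by (meson obtain_subset_with_card_n)
      then obtain c1 c2 c3 where "{c1, c2, c3} \<subseteq> {c. poly ?f c = 0}" "c1 \<noteq> c2" "c1 \<noteq> c3" "c2 \<noteq> c3"
        by (auto simp: card_3_iff)
      thus "\<exists>\<pp> \<qq> \<rr>. infinity_splits_as \<iota> y [(\<pp>, 1), (\<qq>, 1), (\<rr>, 1)]"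
        using splits_three_roots by auto
    qed
  qed
  show ?thesis
    using splits_totally_ramified splits_partially_ramified unramified by blast
qed

end
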